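(* Let $D=\mathbb{R}_+=[0,+\infty)$, let $r\ge 1$ be an integer, let $1\le p,q\le+\infty$, and set $\alpha=r-\frac1p+\frac1q$. Let $\psi,\varrho:D\to(0,+\infty)$ be positive integrable weight functions, and set $\omega=\varrho/\psi$. Let $\kappa:D\to(0,+\infty)$ be a nonincreasing function with $\|\kappa^{1/\alpha}\|_{L_1}<+\infty$, and for each positive integer $n$ let $0=x_0<x_1<\dots<x_n=+\infty$ be the knots determined by $$\int_0^{x_i}\kappa^{1/\alpha}(t)\,\mathrm{d}t=\frac in\,\|\kappa^{1/\alpha}\|_{L_1},\qquad 0\le i\le n.$$ There exists a constant $c_2>0$ depending only on $p$, $q$ and $r$ such that the following holds: for any approximations $\mathcal A_n$ (one for each $n$) that use only information about function values and/or derivatives up to order $r-1$ at the knots $x_0,\dots,x_n$, we have $$\liminf_{n\to\infty}\ \sup_{f\in F^r_{p,\psi}(D)}\frac{\|(f-\mathcal A_nf)\varrho\|_{L_q}}{\|f^{(r)}\psi\|_{L_p}}\,n^{r-(1/p-1/q)_+}\ \ge\ c_2\,\|\kappa^{1/\alpha}\|_{L_1}^{\alpha}\,\mathcal E_p^q(\omega,\kappa),$$ where $x_+=\max(x,0)$.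
   Context: $F^r_{p,\psi}(D)$ denotes the linear space of functions $f:D\to\mathbb{R}$ whose $(r-1)$st derivative is locally absolutely continuous and such that $\|f^{(r)}\psi\|_{L_p}<+\infty$. All norms are over $D$ with Lebesgue measure. The quantity $\mathcal E_p^q(\omega,\kappa)$ is defined by $\mathcal E_p^q(\omega,\kappa)=\|\omega/\kappa\|_{L_\infty}$ if $p\le q$, and by $$\mathcal E_p^q(\omega,\kappa)=\left(\int_D\frac{\kappa^{1/\alpha}(x)}{\|\kappa^{1/\alpha}\|_{L_1}}\left(\frac{\omega(x)}{\kappa(x)}\right)^{\frac{1}{1/q-1/p}}\mathrm{d}x\right)^{1/q-1/p}$$ if $p>q$ (with $1/\infty=0$). *)

theory Defs
  imports "HOL-Analysis.Analysis"
begin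

definition inv_exp :: "ennreal \<Rightarrow> real" where
  "inv_exp p = (if p = \<infinity> then 0 else 1 / enn2real p)"

text \<open>x powr s for x in [0, infinity] and s > 0, with infinity powr s = infinity.\<close>
definition epowr :: "ennreal \<Rightarrow> real \<Rightarrow> ennreal" where
  "epowr x s = (if x = \<infinity> then \<infinity> else ennreal (enn2real x powr s))"

definition Lnorm :: "ennreal \<Rightarrow> (real \<Rightarrow> real) \<Rightarrow> ennreal" where
  "Lnorm p g =
     (if p = \<infinity> then Inf {C. AE x in lebesgue_on {0..}. ennreal \<bar>g x\<bar> \<le> C}
      else epowr (\<integral>\<^sup>+ x. ennreal (\<bar>g x\<bar> powr enn2real p) \<partial>lebesgue_on {0..}) (1 / enn2real p))"

definition Dw :: "(real \<Rightarrow> real) \<Rightarrow> real \<Rightarrow> real" where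
  "Dw g x = vector_derivative g (at x within {0..})"

definition loc_abs_cont_D :: "(real \<Rightarrow> real) \<Rightarrow> bool" where
  "loc_abs_cont_D g \<longleftrightarrow>
     (\<forall>b\<ge>0. \<forall>\<epsilon>>0. \<exists>\<delta>>0. \<forall>(m::nat) a c.
        (\<forall>k<m. 0 \<le> a k \<and> a k \<le> c k \<and> c k \<le> b) \<and>
        (\<forall>k<m. \<forall>l<m. k \<noteq> l \<longrightarrow> c k \<le> a l \<or> c l \<le> a k) \<and>
        (\<Sum>k<m. c k - a k) < \<delta>
        \<longrightarrow> (\<Sum>k<m. \<bar>g (c k) - g (a k)\<bar>) < \<epsilon>)"

definition in_F :: "nat \<Rightarrow> ennreal \<Rightarrow> (real \<Rightarrow> real) \<Rightarrow> (real \<Rightarrow> real) \<Rightarrow> bool" where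
  "in_F r p \<psi> f \<longleftrightarrow>
     (\<forall>j. j + 1 < r \<longrightarrow> (\<forall>x\<ge>0. ((Dw ^^ j) f has_vector_derivative (Dw ^^ Suc j) f x) (at x within {0..}))) \<and>
     loc_abs_cont_D ((Dw ^^ (r - 1)) f) \<and>
     Lnorm p (\<lambda>x. (Dw ^^ r) f x * \<psi> x) < \<infinity>"

definition alpha :: "nat \<Rightarrow> ennreal \<Rightarrow> ennreal \<Rightarrow> real" where
  "alpha r p q = real r - inv_exp p + inv_exp q"

text \<open>t is one of the finite knots x_0, ..., x_{n-1} (x_n = +infinity is not a point of D).\<close>
definition is_knot :: "(real \<Rightarrow> real) \<Rightarrow> real \<Rightarrow> nat \<Rightarrow> real \<Rightarrow> bool" where
  "is_knot \<kappa> a n t \<longleftrightarrow> 0 \<le> t \<and> (\<exists>i<n.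
     Lnorm 1 (\<lambda>s. indicator {0..t} s * \<kappa> s powr (1 / a))
       = ennreal (real i / real n) * Lnorm 1 (\<lambda>s. \<kappa> s powr (1 / a)))"

definition Epq :: "ennreal \<Rightarrow> ennreal \<Rightarrow> real \<Rightarrow> (real \<Rightarrow> real) \<Rightarrow> (real \<Rightarrow> real) \<Rightarrow> ennreal" where
  "Epq p q a \<omega> \<kappa> =
     (if p \<le> q then Lnorm \<infinity> (\<lambda>x. \<omega> x / \<kappa> x)
      else epowr (\<integral>\<^sup>+ x. ennreal (\<kappa> x powr (1 / a) / enn2real (Lnorm 1 (\<lambda>s. \<kappa> s powr (1 / a)))
                          * (\<omega> x / \<kappa> x) powr (1 / (inv_exp q - inv_exp p))) \<partial>lebesgue_on {0..})
                 (inv_exp q - inv_exp p))"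

definition worst_err :: "nat \<Rightarrow> ennreal \<Rightarrow> ennreal \<Rightarrow> (real \<Rightarrow> real) \<Rightarrow> (real \<Rightarrow> real)
     \<Rightarrow> ((real \<Rightarrow> real) \<Rightarrow> real \<Rightarrow> real) \<Rightarrow> ennreal" where
  "worst_err r p q \<psi> \<rho> An =
     (SUP f \<in> {f. in_F r p \<psi> f \<and> Lnorm p (\<lambda>x. (Dw ^^ r) f x * \<psi> x) \<noteq> 0}.
        Lnorm q (\<lambda>x. (f x - An f x) * \<rho> x) / Lnorm p (\<lambda>x. (Dw ^^ r) f x * \<psi> x))"

end

theory Submission
  imports Defs
begin

text \<open>
  If $f$ vanishes at all knots together with its derivatives of order less than $r$, then $A_n$ cannot
  distinguish $f$ from $-f$, so the worst-case error is at least half of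
  $\|f\varrho\|_{L_q} / \|f^{(r)}\psi\|_{L_p}$. Since $\psi$ and $\varrho$ are merely measurable, the usual
  smooth bumps are replaced by $r$-fold integrals of step functions restricted to a set $S$ on which
  $\psi$ and $\varrho$ are constant up to a factor 2. The $r + 1$ step heights are chosen by linear
  algebra so that all $r$ integrals vanish at the right end of the interval, and finite differences
  bound the result from below as soon as $S$ fills almost the whole interval. By Lebesgue's density
  theorem almost every point eventually lies in knot intervals of that kind, and there the ratio for a
  single bump is of order $(\|\kappa^{1/\alpha}\|_{L_1}/n)^\alpha \omega/\kappa$. One bump yields the case
  $p \le q$. For $p > q$ the bumps of all good intervals are combined with the weights from the equality
  case of Hoelder's inequality, and Fatou's lemma gives the limit.
\<close>

section \<open>Iterated integrals\<close>

text \<open>The number \<alpha> is the scaling exponent of one bump: on an interval of length h the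
  \<open>r\<close>-fold integral has height of order \<open>h ^ r\<close>, and the two norms
  contribute h to the powers 1/q and -1/p. The knots equidistribute the mass of \<open>K\<close>,
  the power 1/\<alpha> of \<kappa>, so a knot interval from a to b satisfies L/n \<le>
  \<open>K a * (b - a)\<close>. Raised to the power \<alpha>, this bounds the length from below by
  \<open>\<kappa> a\<close>, which is why \<kappa> is compared only between x and the left endpoint.

  The weights are cut into dyadic bands. There are countably many bands, so one null set serves all
  of them. Nothing is known about S inside its interval except its density; hence the bumps are
  estimated through integrals over windows, never through pointwise values of the restricted step
  function.

  The constant is \<open>bump_const r\<close> squared over 128 = 16 * 8: the 16 is the loss on one
  good interval, and the 8 is the price of replacing the weight at a point by that at a
  representative of its knot interval. The unbounded last knot interval never carries a bump; every
  fixed positive point lies in a bounded one for large n.\<close>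

lemma lebesgue_differentiation:
  fixes g :: "real \<Rightarrow> real"
  assumes g: "\<And>a b. g integrable_on {a..b}"
  shows "AE x in lebesgue. \<forall>c<x. ((\<lambda>t. integral {c..t} g) has_real_derivative g x) (at x)"
proof -
  obtain N where N: "negligible N" "\<And>x e. \<lbrakk>x \<notin> N; 0 < e\<rbrakk> \<Longrightarrow>
      \<exists>d>0. \<forall>h. 0 < h \<and> h < d \<longrightarrow> \<bar>integral {x..x + h} g / h - g x\<bar> < e"
    using integrable_ccontinuous_explicit[of g] g by (auto simp: divide_inverse mult.commute)
  \<comment> \<open>\<open>integrable_ccontinuous_explicit\<close> is used here for h > 0. Left-hand
    quotients of g at x are right-hand quotients of the reflected function at -x, so the exceptional
    set is N together with the reflection of N'. It does not depend on c, because the quotients only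
    see integrals between x and x + h.\<close>
  have "(\<lambda>x. g (- x)) integrable_on {a..b}" for a b
    using g[of "-b" "-a"] Henstock_Kurzweil_Integration.integrable_reflect_real[where f=g and a="- b" and b="- a"]
    by (simp del: Henstock_Kurzweil_Integration.integrable_reflect_real)
  then obtain N' where N': "negligible N'" "\<And>x e. \<lbrakk>x \<notin> N'; 0 < e\<rbrakk> \<Longrightarrow>
      \<exists>d>0. \<forall>h. 0 < h \<and> h < d \<longrightarrow> \<bar>integral {x..x + h} (\<lambda>x. g (- x)) / h - g (- x)\<bar> < e"
    using integrable_ccontinuous_explicit[of "\<lambda>x. g (- x)"] by (auto simp: divide_inverse mult.commute)
  have neg: "negligible (N \<union> uminus ` N')"
    using N(1) N'(1) by (intro negligible_Un negligible_differentiable_image_negligible) (auto intro!: derivative_intros)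
  have "((\<lambda>t. integral {c..t} g) has_real_derivative g x) (at x)"
    if x: "x \<notin> N \<union> uminus ` N'" and c: "c < x" for x c
    unfolding DERIV_def LIM_def
  proof (intro allI impI)
    fix e :: real assume e: "e > 0"
    obtain d1 where d1: "d1 > 0" "\<And>h. 0 < h \<Longrightarrow> h < d1 \<Longrightarrow> \<bar>integral {x..x + h} g / h - g x\<bar> < e"
      using N(2)[of x e] x e by auto
    have "- x \<notin> N'" using x by (metis UnCI image_eqI minus_minus)
    then obtain d2 where d2: "d2 > 0"
      "\<And>h. 0 < h \<Longrightarrow> h < d2 \<Longrightarrow> \<bar>integral {- x..- x + h} (\<lambda>x. g (- x)) / h - g x\<bar> < e"
      using N'(2)[of "- x" e] e by auto
    have "\<bar>(integral {c..x + h} g - integral {c..x} g) / h - g x\<bar> < e"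
      if h: "h \<noteq> 0" "\<bar>h\<bar> < min (min d1 d2) (x - c)" for h
    proof (cases "h > 0")
      case True
      have "integral {c..x + h} g = integral {c..x} g + integral {x..x + h} g"
        using Henstock_Kurzweil_Integration.integral_combine[of c x "x + h" g] c True g by simp
      then show ?thesis using d1(2)[of h] True h by auto
    next
      case False
      then have hn: "h < 0" "- h < d2" "- h < x - c" using h by auto
      have "integral {c..x} g = integral {c..x + h} g + integral {x + h..x} g"
        using Henstock_Kurzweil_Integration.integral_combine[of c "x + h" x g] hn g by simp
      moreover have "integral {- x..- x + - h} (\<lambda>x. g (- x)) = integral {x + h..x} g"
        using Henstock_Kurzweil_Integration.integral_reflect_real[of x "x + h" g] by simp
      ultimately show ?thesis using d2(2)[of "- h"] hn by (simp add: field_simps)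
    qed
    then show "\<exists>s>0. \<forall>y. y \<noteq> 0 \<and> dist y 0 < s \<longrightarrow>
        dist ((integral {c..x + y} g - integral {c..x} g) / y) (g x) < e"
      using d1(1) d2(1) c by (intro exI[of _ "min (min d1 d2) (x - c)"]) (auto simp: dist_real_def)
  qed
  then show ?thesis
    using neg by (intro AE_I'[where N="N \<union> uminus ` N'"]) (auto simp: negligible_iff_null_sets)
qed

text \<open>Vanishing on the negative axis makes every iterated integral from 0 vanish there too, so
  continuity and derivatives at 0 can be stated two-sidedly and no endpoint case arises.\<close>

definition bdd_meas :: "(real \<Rightarrow> real) \<Rightarrow> bool" where
  "bdd_meas g \<longleftrightarrow> g \<in> borel_measurable lebesgue \<and> (\<forall>x<0. g x = 0) \<and> (\<exists>B. \<forall>x. \<bar>g x\<bar> \<le> B)"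

lemma bdd_meas_absint:
  assumes "bdd_meas g" shows "g absolutely_integrable_on {a..b}"
proof -
  obtain B where "\<forall>x. \<bar>g x\<bar> \<le> B" using assms by (auto simp: bdd_meas_def)
  then show ?thesis
    using assms by (intro measurable_bounded_by_integrable_imp_absolutely_integrable[where g="\<lambda>_. B"])
      (auto simp: bdd_meas_def intro: measurable_restrict_space1)
qed

lemma bdd_meas_int: "bdd_meas g \<Longrightarrow> g integrable_on {a..b}"
  using bdd_meas_absint by (auto simp: absolutely_integrable_on_def)

lemma bdd_meas_sum:
  assumes "\<And>i. i \<in> I \<Longrightarrow> bdd_meas (g i)" shows "bdd_meas (\<lambda>x. \<Sum>i\<in>I. w i * g i x)"
proof -
  obtain B where B: "\<And>i x. i \<in> I \<Longrightarrow> \<bar>g i x\<bar> \<le> B i" using assms unfolding bdd_meas_def by metis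
  have "\<bar>\<Sum>i\<in>I. w i * g i x\<bar> \<le> (\<Sum>i\<in>I. \<bar>w i\<bar> * B i)" for x
    by (rule order_trans[OF sum_abs]) (auto simp: abs_mult B intro!: sum_mono mult_left_mono)
  then show ?thesis using assms unfolding bdd_meas_def
    by (auto intro!: borel_measurable_sum borel_measurable_times)
qed

primrec iint :: "nat \<Rightarrow> (real \<Rightarrow> real) \<Rightarrow> real \<Rightarrow> real" where
  "iint 0 g = g"
| "iint (Suc k) g = (\<lambda>x. integral {0..x} (iint k g))"

text \<open>With the lower limit moved strictly below both 0 and x, the point x becomes interior,
  and the theorems on indefinite integrals yield two-sided statements.\<close>

lemma integral_drop_negative:
  fixes g :: "real \<Rightarrow> real"
  assumes "\<And>x. x < 0 \<Longrightarrow> g x = 0" "c \<le> 0"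
  shows "integral {c..x} g = integral {0..x} g"
proof (rule integral_spike_set)
  have "{y \<in> {c..x} - {0..x}. g y \<noteq> 0} = {}" using assms(1) by fastforce
  then show "negligible {y \<in> {c..x} - {0..x}. g y \<noteq> 0}" by (simp only: negligible_empty)
  have "{y \<in> {0..x} - {c..x}. g y \<noteq> 0} = {}" using assms(2) by auto
  then show "negligible {y \<in> {0..x} - {c..x}. g y \<noteq> 0}" by (simp only: negligible_empty)
qed

lemma continuous_integral_from_0:
  fixes g :: "real \<Rightarrow> real"
  assumes "\<And>x. x < 0 \<Longrightarrow> g x = 0" "\<And>a b. g integrable_on {a..b}"
  shows "isCont (\<lambda>x. integral {0..x} g) x"
proof -
  define c where "c = min x 0 - 1"
  have "continuous_on {c..x+1} (\<lambda>x. integral {c..x} g)"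
    using assms(2) by (rule indefinite_integral_continuous_1)
  then have "continuous_on {c..x+1} (\<lambda>x. integral {0..x} g)"
    using integral_drop_negative[of g c, OF assms(1)] by (simp add: c_def)
  then show ?thesis
    by (rule continuous_on_interior) (auto simp: c_def)
qed

lemma DERIV_integral_from_0:
  fixes g :: "real \<Rightarrow> real"
  assumes "\<And>x. x < 0 \<Longrightarrow> g x = 0" "\<And>x. isCont g x"
  shows "((\<lambda>x. integral {0..x} g) has_real_derivative g x) (at x)"
proof -
  define c where "c = min x 0 - 1"
  have c: "c \<le> 0" "c < x" by (auto simp: c_def)
  have "((\<lambda>x. integral {c..x} g) has_real_derivative g x) (at x within {c..x+1})"
    using assms(2) c by (intro integral_has_real_derivative) (auto intro: continuous_at_imp_continuous_on)
  then show ?thesis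
    using integral_drop_negative[of g c, OF assms(1) c(1)] at_within_Icc_at[of c x "x+1"] c by simp
qed

lemma iint_neg: "(\<And>x. x < 0 \<Longrightarrow> g x = 0) \<Longrightarrow> x < 0 \<Longrightarrow> iint k g x = 0"
  by (cases k) auto

lemma bdd_measD: "bdd_meas g \<Longrightarrow> x < 0 \<Longrightarrow> g x = 0"
  by (auto simp: bdd_meas_def)

lemma isCont_iint: "bdd_meas g \<Longrightarrow> isCont (iint (Suc k) g) x"
proof (induction k arbitrary: x)
  case 0
  then show ?case using continuous_integral_from_0[of g] bdd_measD bdd_meas_int by simp
next
  case (Suc k)
  have "isCont (\<lambda>x. integral {0..x} (iint (Suc k) g)) x"
    using Suc bdd_measD
    by (intro continuous_integral_from_0 iint_neg integrable_continuous_real continuous_at_imp_continuous_on) auto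
  then show ?case by simp
qed

lemma iint_integrable: "bdd_meas g \<Longrightarrow> iint k g integrable_on {a..b}"
  using isCont_iint bdd_meas_int
  by (cases k) (auto intro!: integrable_continuous_real continuous_at_imp_continuous_on simp del: iint.simps(2))

lemma DERIV_iint:
  assumes "bdd_meas g"
  shows "(iint (Suc (Suc k)) g has_real_derivative iint (Suc k) g x) (at x)"
proof -
  have "((\<lambda>x. integral {0..x} (iint (Suc k) g)) has_real_derivative iint (Suc k) g x) (at x)"
    using isCont_iint[OF assms] bdd_measD[OF assms] by (intro DERIV_integral_from_0 iint_neg) auto
  then show ?thesis by simp
qed

lemma AE_DERIV_iint:
  assumes "bdd_meas g"
  shows "AE x in lebesgue. (iint 1 g has_real_derivative g x) (at x)"
  using lebesgue_differentiation[of g, OF bdd_meas_int[OF assms]]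
proof eventually_elim
  case (elim x)
  define c where "c = min x 0 - 1"
  show ?case using elim[rule_format, of c] integral_drop_negative[of g c] bdd_measD[OF assms]
    by (simp add: c_def)
qed

lemma iint_sum:
  assumes "\<And>i. i \<in> I \<Longrightarrow> bdd_meas (g i)" "finite I"
  shows "iint k (\<lambda>x. \<Sum>i\<in>I. w i * g i x) x = (\<Sum>i\<in>I. w i * iint k (g i) x)"
proof (induction k arbitrary: x)
  case (Suc k)
  have "iint (Suc k) (\<lambda>x. \<Sum>i\<in>I. w i * g i x) x = integral {0..x} (\<lambda>x. \<Sum>i\<in>I. w i * iint k (g i) x)"
    using Suc by (simp cong: Henstock_Kurzweil_Integration.integral_cong)
  also have "\<dots> = (\<Sum>i\<in>I. integral {0..x} (\<lambda>x. w i * iint k (g i) x))"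
    using assms iint_integrable by (intro integral_sum) (auto intro!: integrable_on_cmult_left[where 'b=real, simplified])
  finally show ?case by simp
qed simp

lemma iint_diff_eq:
  assumes "bdd_meas g" "0 \<le> x" "x \<le> y"
  shows "iint (Suc k) g y - iint (Suc k) g x = integral {x..y} (iint k g)"
  using Henstock_Kurzweil_Integration.integral_combine[of 0 x y "iint k g"] assms iint_integrable by simp

lemma iint_zero_left:
  assumes "\<And>x. x < a \<Longrightarrow> g x = 0" "x \<le> a"
  shows "iint (Suc k) g x = 0"
  using assms(2)
proof (induction k arbitrary: x)
  case 0
  have "integral {0..x} g = integral {0..x} (\<lambda>_. 0)"
    using 0 assms(1) by (intro integral_spike[of "{a}"]) auto
  then show ?case by simp
next
  case (Suc k)
  then have "integral {0..x} (iint (Suc k) g) = integral {0..x} (\<lambda>_. 0)"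
    by (intro Henstock_Kurzweil_Integration.integral_cong) auto
  then show ?case by simp
qed

text \<open>Beyond b each integral continues from its value at b with an integrand that vanishes by
  induction. Hence the \<open>r\<close> conditions at the single point b keep all the integrals at
  zero to its right.\<close>

lemma iint_zero_right:
  assumes "bdd_meas g" "\<And>x. x \<ge> b \<Longrightarrow> g x = 0" "\<And>k. 1 \<le> k \<Longrightarrow> k \<le> r \<Longrightarrow> iint k g b = 0"
    and "0 \<le> b" "b \<le> x" "k \<le> r"
  shows "iint k g x = 0"
  using assms(5,6)
proof (induction k arbitrary: x)
  case (Suc k)
  have "integral {b..x} (iint k g) = integral {b..x} (\<lambda>_. 0)"
    using Suc by (intro Henstock_Kurzweil_Integration.integral_cong) auto
  then show ?case using iint_diff_eq[OF assms(1,4), of x k] Suc.prems assms(3)[of "Suc k"]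
    by (simp del: iint.simps)
qed (use assms in auto)

lemma iint_bound:
  assumes g: "bdd_meas g" "\<And>x. \<bar>g x\<bar> \<le> 1" "\<And>x. x < a \<Longrightarrow> g x = 0"
    and "0 \<le> a" "a \<le> x" "x \<le> b"
  shows "\<bar>iint k g x\<bar> \<le> (b - a) ^ k"
  using assms(5,6)
proof (induction k arbitrary: x)
  case (Suc k)
  have "\<bar>integral {a..x} (iint k g)\<bar> \<le> integral {a..x} (\<lambda>_. (b - a) ^ k)"
    using Suc iint_integrable[OF g(1)] by (intro Henstock_Kurzweil_Integration.integral_norm_bound_integral[where 'a=real, unfolded real_norm_def]) auto
  also have "\<dots> \<le> (b - a) * (b - a) ^ k"
    using Suc.prems by (auto intro!: mult_right_mono)
  finally show ?case
    using iint_diff_eq[OF g(1) assms(4), of x k] iint_zero_left[of a g a k, OF g(3)] Suc.prems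
    by (simp del: iint.simps)
qed (use g in auto)

text \<open>Serves two purposes in \<open>exists_bump\<close>: since the integrals vanish at both
  ends, a point of large value stays away from the ends, and the large value persists on a
  neighbourhood of that point.\<close>

lemma iint_Lipschitz:
  assumes g: "bdd_meas g" "\<And>x. \<bar>g x\<bar> \<le> 1" "\<And>x. x < a \<Longrightarrow> g x = 0"
    and "0 \<le> a" "a \<le> x" "x \<le> y" "y \<le> b"
  shows "\<bar>iint (Suc k) g y - iint (Suc k) g x\<bar> \<le> (b - a) ^ k * (y - x)"
proof -
  have "\<bar>integral {x..y} (iint k g)\<bar> \<le> integral {x..y} (\<lambda>_. (b - a) ^ k)"
    using assms iint_integrable[OF g(1)] by (intro Henstock_Kurzweil_Integration.integral_norm_bound_integral[where 'a=real, unfolded real_norm_def] iint_bound) auto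
  then show ?thesis using iint_diff_eq[OF g(1), of x y k] assms by (simp del: iint.simps add: mult.commute)
qed

section \<open>Finite differences of iterated integrals\<close>

primrec fdiff :: "nat \<Rightarrow> real \<Rightarrow> (real \<Rightarrow> real) \<Rightarrow> real \<Rightarrow> real" where
  "fdiff 0 s f x = f x"
| "fdiff (Suc k) s f x = fdiff k s f (x + s) - fdiff k s f x"

lemma DERIV_fdiff:
  assumes "\<And>y. (f has_real_derivative f' y) (at y)"
  shows "(fdiff k s f has_real_derivative fdiff k s f' x) (at x)"
proof (induction k arbitrary: x)
  case 0
  have "fdiff 0 s f = f" by auto
  then show ?case using assms by simp
next
  case (Suc k)
  have "fdiff (Suc k) s f = (\<lambda>x. fdiff k s f (x + s) - fdiff k s f x)" by auto
  moreover have "((\<lambda>x. fdiff k s f (x + s)) has_real_derivative fdiff k s f' (x + s)) (at x)"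
    using Suc[of "x + s"] by (simp add: DERIV_shift)
  ultimately show ?case using Suc[of x] by (auto intro: DERIV_diff)
qed

text \<open>\<open>2 ^ k\<close> is the sum of the binomial coefficients of the difference. The
  contrapositive is what gets used: a large difference forces a large value at one of the
  nodes.\<close>

lemma fdiff_less:
  assumes "\<And>i. i \<le> k \<Longrightarrow> \<bar>f (x + real i * s)\<bar> < m"
  shows "\<bar>fdiff k s f x\<bar> < 2 ^ k * m"
  using assms
proof (induction k arbitrary: x)
  case (Suc k)
  have "\<bar>fdiff k s f x\<bar> < 2 ^ k * m" by (rule Suc.IH) (use Suc.prems in auto)
  moreover have "\<bar>fdiff k s f (x + s)\<bar> < 2 ^ k * m"
  proof (rule Suc.IH)
    fix i assume "i \<le> k"
    then show "\<bar>f (x + s + real i * s)\<bar> < m" using Suc.prems[of "Suc i"] by (simp add: algebra_simps)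
  qed
  ultimately show ?case by simp
qed (use assms in auto)

text \<open>Each difference undoes one integration by the mean value theorem, at the cost of a
  factor s. What remains at the bottom is an integral of g over one window of length s, which
  density can bound although g may vanish at many points.\<close>

lemma fdiff_iint_ge:
  assumes g: "bdd_meas g" and s: "0 < s" and A: "0 \<le> A"
    and int: "\<And>x. A \<le> x \<Longrightarrow> x + s \<le> B \<Longrightarrow> s / 2 \<le> integral {x..x + s} g"
    and "A \<le> x" "x + real (Suc k) * s \<le> B"
  shows "s ^ Suc k / 2 \<le> fdiff (Suc k) s (iint (Suc k) g) x"
  using assms(5,6)
proof (induction k arbitrary: x)
  case 0
  then show ?case using iint_diff_eq[OF g, of x "x + s" 0] int[of x] A s by simp
next
  case (Suc k)
  let ?\<phi> = "fdiff (Suc k) s (iint (Suc (Suc k)) g)"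
  have "\<exists>z. x < z \<and> z < x + s \<and> ?\<phi> (x + s) - ?\<phi> x = (x + s - x) * fdiff (Suc k) s (iint (Suc k) g) z"
    using s by (intro MVT2 DERIV_fdiff DERIV_iint g) auto
  then obtain z where z: "x < z" "z < x + s" "?\<phi> (x + s) - ?\<phi> x = s * fdiff (Suc k) s (iint (Suc k) g) z"
    by auto
  \<comment> \<open>z lies less than one step to the right of x, so \<open>Suc k\<close> further
    steps from z still end before B.\<close>
  have "s ^ Suc k / 2 \<le> fdiff (Suc k) s (iint (Suc k) g) z"
    using z Suc.prems by (intro Suc.IH) (auto simp: algebra_simps)
  then have "s * (s ^ Suc k / 2) \<le> ?\<phi> (x + s) - ?\<phi> x" using z s by (metis mult_left_mono less_imp_le)
  then show ?case by (simp del: iint.simps)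
qed

section \<open>Bump functions on dense subsets of an interval\<close>

text \<open>Gaussian elimination, one equation at a time. If equation j has a pivot
  \<open>k0\<close>, that unknown is eliminated from the other equations, and its coefficient in the
  end is the one dictated by equation j. The solution stays nontrivial because the remaining
  unknowns keep their values.\<close>

lemma underdetermined_system:
  fixes M :: "'a \<Rightarrow> 'b \<Rightarrow> real"
  assumes "finite J" "finite K" "card J < card K"
  shows "\<exists>c. (\<exists>k\<in>K. c k \<noteq> 0) \<and> (\<forall>j\<in>J. (\<Sum>k\<in>K. c k * M k j) = 0)"
  using assms
proof (induction J arbitrary: K M rule: finite_induct)
  case empty
  then have "K \<noteq> {}" by auto
  then show ?case by (intro exI[of _ "\<lambda>_. 1"]) auto
next
  case (insert j J)
  show ?case
  proof (cases "\<forall>k\<in>K. M k j = 0")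
    case True
    then show ?thesis using insert.IH[of K M] insert by auto
  next
    case False
    then obtain k0 where k0: "k0 \<in> K" "M k0 j \<noteq> 0" by auto
    define K' where "K' = K - {k0}"
    have K': "finite K'" "card J < card K'" "K = insert k0 K'" "k0 \<notin> K'"
      using insert k0 by (auto simp: K'_def card_Diff_singleton)
    obtain c where c: "\<exists>k\<in>K'. c k \<noteq> 0" "\<forall>i\<in>J. (\<Sum>k\<in>K'. c k * (M k i - M k j / M k0 j * M k0 i)) = 0"
      using insert.IH[OF K'(1,2), of "\<lambda>k i. M k i - M k j / M k0 j * M k0 i"] by auto
    define c' where "c' = (\<lambda>k. if k = k0 then - (\<Sum>k\<in>K'. c k * M k j) / M k0 j else c k)"
    have eq: "(\<Sum>k\<in>K. c' k * M k i) = - (\<Sum>k\<in>K'. c k * M k j) / M k0 j * M k0 i + (\<Sum>k\<in>K'. c k * M k i)" for i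
    proof -
      have "(\<Sum>k\<in>K'. c' k * M k i) = (\<Sum>k\<in>K'. c k * M k i)"
        using K'(4) by (intro sum.cong) (auto simp: c'_def)
      then show ?thesis using K' by (simp add: c'_def)
    qed
    have "(\<Sum>k\<in>K. c' k * M k j) = 0" using k0 by (simp add: eq)
    moreover have "(\<Sum>k\<in>K. c' k * M k i) = 0" if "i \<in> J" for i
    proof -
      have "(\<Sum>k\<in>K'. c k * (M k i - M k j / M k0 j * M k0 i)) =
          (\<Sum>k\<in>K'. c k * M k i) - (\<Sum>k\<in>K'. c k * M k j) / M k0 j * M k0 i"
        by (simp add: sum_subtractf sum_distrib_right sum_divide_distrib sum_distrib_left algebra_simps)
      then show ?thesis using c(2) that by (simp add: eq)
    qed
    moreover have "\<exists>k\<in>K. c' k \<noteq> 0" using c(1) K' by (auto simp: c'_def)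
    ultimately show ?thesis by (intro exI[of _ c']) auto
  qed
qed

text \<open>What S misses of a subinterval is at most what it misses of the whole interval. The loss
  is therefore absolute, and useful only for windows whose length is comparable to
  \<open>b - a\<close>.\<close>

lemma measure_Int_ge_of_dense:
  assumes S: "S \<in> sets lebesgue" "S \<subseteq> {a..b}" "measure lebesgue S \<ge> (1 - c) * (b - a)" and "a \<le> b"
    and xy: "a \<le> x" "x \<le> y" "y \<le> b"
  shows "measure lebesgue (S \<inter> {x..y}) \<ge> (y - x) - c * (b - a)"
proof -
  have Sm: "S \<in> lmeasurable" using S by (metis fmeasurableI2 lmeasurable_cbox cbox_interval)
  have "measure lebesgue ({x..y} - S) \<le> measure lebesgue ({a..b} - S)"
    using xy Sm by (intro measure_mono_fmeasurable) (auto intro!: fmeasurable_Diff)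
  also have "\<dots> = (b - a) - measure lebesgue S"
    using measurable_measure_Diff[of "{a..b}" lebesgue S] S \<open>a \<le> b\<close> Sm by simp
  finally have 1: "measure lebesgue ({x..y} - S) \<le> c * (b - a)" using S(3) by (simp add: algebra_simps)
  have "{x..y} = (S \<inter> {x..y}) \<union> ({x..y} - S)" by auto
  then have "measure lebesgue {x..y} \<le> measure lebesgue (S \<inter> {x..y}) + measure lebesgue ({x..y} - S)"
    using Sm by (metis fmeasurable.Int fmeasurableD fmeasurable_Diff lmeasurable_interval(1) measure_Un_le)
  then show ?thesis using 1 xy by simp
qed

lemma integral_indicator_Icc:
  fixes a b :: real
  assumes "S \<in> sets lebesgue"
  shows "integral {a..b} (indicat_real S) = measure lebesgue (S \<inter> {a..b})"
proof -
  have "S \<inter> {a..b} \<in> lmeasurable"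
    using fmeasurable_Int_fmeasurable[OF lmeasurable_interval(1)[of a b] assms] by (simp add: inf_commute)
  then have "measure lebesgue (S \<inter> {a..b}) = integral (S \<inter> {a..b}) (\<lambda>_. 1)"
    by (simp add: lmeasure_integral)
  also have "\<dots> = integral {a..b} (\<lambda>y. if y \<in> S then 1 else 0)"
    by (rule Henstock_Kurzweil_Integration.integral_restrict_Int[symmetric])
  finally show ?thesis by (simp add: indicator_def[abs_def] of_bool_def)
qed

text \<open>Chosen so that \<open>bump_const r * h ^ r\<close> is exactly half of the value
  \<open>s ^ r / 2 ^ (r + 1)\<close> forced at some node in \<open>exists_bump\<close>, where
  \<open>s = h / (r + 1)\<^sup>2\<close> is the step of the differences. The same number is small
  enough to serve as the admissible density defect.\<close>

definition bump_const :: "nat \<Rightarrow> real" where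
  "bump_const r = 1 / ((real r + 1) ^ (2 * r) * 2 ^ (r + 2))"

lemma bump_const: "0 < bump_const r" "r \<ge> 1 \<Longrightarrow> bump_const r \<le> 1 / (2 * (real r + 1)\<^sup>2)"
proof -
  show "0 < bump_const r" by (simp add: bump_const_def)
  assume r: "r \<ge> 1"
  have "(real r + 1)\<^sup>2 * 2 ^ 1 \<le> (real r + 1) ^ (2 * r) * 2 ^ (r + 2)"
    using r by (intro mult_mono power_increasing) auto
  then show "bump_const r \<le> 1 / (2 * (real r + 1)\<^sup>2)"
    unfolding bump_const_def using r by (intro divide_left_mono) (auto simp: mult.commute)
qed

text \<open>A density above one half forces two dense subsets of the same interval to meet;
  \<open>good_compare\<close> rests on this.\<close>

lemma bump_const_less_half:
  assumes "r \<ge> 1" shows "bump_const r < 1 / 2"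
proof -
  have "2 ^ 2 \<le> (real r + 1)\<^sup>2" using assms by (intro power_mono) auto
  then have "1 / (2 * (real r + 1)\<^sup>2) \<le> 1 / (2 * 2 ^ 2)" by (intro divide_left_mono) auto
  with bump_const(2)[OF assms] have "bump_const r \<le> 1 / (2 * 2 ^ 2)" by (rule order_trans)
  then show ?thesis by simp
qed

text \<open>The interval is cut into \<open>r + 1\<close> cells, and g is constant on the part of S
  in each cell. One more cell than there are conditions at b leaves a nontrivial choice of heights.
  Differences inside the cell of largest height then show that cancellation between cells cannot
  flatten the \<open>r\<close>-fold integral everywhere.\<close>

lemma exists_bump:
  assumes r: "r \<ge> 1" and ab: "0 \<le> a" "a < b"
    and S: "S \<in> sets lebesgue" "S \<subseteq> {a..<b}" "measure lebesgue S \<ge> (1 - bump_const r) * (b - a)"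
  obtains g T where "bdd_meas g" "\<And>x. \<bar>g x\<bar> \<le> 1" "\<And>x. x \<notin> S \<Longrightarrow> g x = 0"
    "\<And>k x. 1 \<le> k \<Longrightarrow> k \<le> r \<Longrightarrow> x \<le> a \<or> b \<le> x \<Longrightarrow> iint k g x = 0"
    "T \<in> sets lebesgue" "T \<subseteq> S" "measure lebesgue T \<ge> bump_const r * (b - a)"
    "\<And>x. x \<in> T \<Longrightarrow> \<bar>iint r g x\<bar> \<ge> bump_const r * (b - a) ^ r"
proof -
  define h where "h = b - a"
  define d where "d = h / (real r + 1)"
  define s where "s = d / (real r + 1)"
  define J where "J k = {a + real k * d..<a + (real k + 1) * d}" for k
  have h: "h > 0" and d: "d > 0" and s: "s > 0" using ab by (auto simp: h_def d_def s_def)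
  have rd: "(real r + 1) * d = h" and rs: "(real r + 1) * s = d" by (auto simp: d_def s_def add_nonneg_eq_0_iff)
  have J_disj: "k = l" if "x \<in> J k" "x \<in> J l" for x k l
  proof -
    have False if "x \<in> J k" "x \<in> J l" "k < l" for k l
    proof -
      have "(real k + 1) * d \<le> real l * d" using that d by (intro mult_right_mono) auto
      then show False using that by (auto simp: J_def)
    qed
    then show ?thesis using that by (metis linorder_neqE_nat)
  qed
  have ind: "bdd_meas (indicator (S \<inter> J k))" for k
    using S ab by (auto simp: bdd_meas_def J_def indicator_def intro!: borel_measurable_indicator exI[of _ 1])
  obtain c0 :: "nat \<Rightarrow> real" where c0: "\<exists>k\<in>{..r}. c0 k \<noteq> 0"
      "\<forall>j\<in>{1..r}. (\<Sum>k\<in>{..r}. c0 k * iint j (indicator (S \<inter> J k)) b) = 0"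
    using underdetermined_system[of "{1..r}" "{..r}" "\<lambda>k j. iint j (indicator (S \<inter> J k)) b"] by auto
  obtain k0 where "k0 \<in> {..r}" and Max: "Max ((\<lambda>k. \<bar>c0 k\<bar>) ` {..r}) = \<bar>c0 k0\<bar>"
    using obtains_MAX[of "{..r}" "\<lambda>k. \<bar>c0 k\<bar>"] by blast
  then have k0: "k0 \<le> r" "\<And>k. k \<le> r \<Longrightarrow> \<bar>c0 k\<bar> \<le> \<bar>c0 k0\<bar>"
    by (auto simp flip: Max)
  have c0k0: "c0 k0 \<noteq> 0" using c0(1) k0 by force
  \<comment> \<open>Scaling the coefficient of largest modulus to 1 gives the bound 1 for g and
    makes g coincide with the indicator of S on the cell of \<open>k0\<close>, where the differences
    are taken.\<close>
  define c where "c k = c0 k / c0 k0" for k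
  have c: "c k0 = 1" "\<And>k. k \<le> r \<Longrightarrow> \<bar>c k\<bar> \<le> 1"
    using c0k0 k0 by (auto simp: c_def abs_divide divide_le_eq)
  define g where "g x = (\<Sum>k\<in>{..r}. c k * indicator (S \<inter> J k) x)" for x
  have g: "bdd_meas g" unfolding g_def using ind by (intro bdd_meas_sum)
  have gb: "iint j g b = 0" if "1 \<le> j" "j \<le> r" for j
  proof -
    have "iint j g b = (\<Sum>k\<in>{..r}. c k * iint j (indicator (S \<inter> J k)) b)"
      unfolding g_def using ind by (intro iint_sum) auto
    also have "\<dots> = (\<Sum>k\<in>{..r}. c0 k * iint j (indicator (S \<inter> J k)) b) / c0 k0"
      by (simp add: c_def sum_divide_distrib)
    finally show ?thesis using c0(2) that by simp
  qed
  have g_eq: "g x = c k * indicator S x" if "x \<in> J k" "k \<le> r" for x k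
  proof -
    have "g x = (\<Sum>l\<in>{..r}. if l = k then c k * indicator S x else 0)"
      unfolding g_def using that J_disj by (intro sum.cong) (auto simp: indicator_def)
    then show ?thesis using that by simp
  qed
  have gS: "g x = 0" if "x \<notin> S" for x using that by (simp add: g_def)
  have g1: "\<bar>g x\<bar> \<le> 1" for x
  proof (cases "\<exists>k\<le>r. x \<in> J k")
    case True
    then show ?thesis using g_eq c(2) by (auto simp: indicator_def)
  next
    case False
    then have "g x = 0" unfolding g_def by (intro sum.neutral) (auto simp: indicator_def)
    then show ?thesis by simp
  qed
  have ga: "g x = 0" if "x < a" for x using that gS S(2) by force
  have gb': "g x = 0" if "x \<ge> b" for x using that gS S(2) by force
  define A where "A = a + real k0 * d"
  have A: "a \<le> A" "A + d \<le> b"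
  proof -
    show "a \<le> A" using d by (simp add: A_def)
    have "(real k0 + 1) * d \<le> (real r + 1) * d" using k0 d by (intro mult_right_mono) auto
    then show "A + d \<le> b" using rd by (simp add: A_def h_def algebra_simps)
  qed
  have S': "S \<subseteq> {a..b}" using S(2) by force
  have ch: "bump_const r * h \<le> s / 2"
  proof -
    have "bump_const r * h \<le> 1 / (2 * (real r + 1)\<^sup>2) * h"
      using h bump_const(2)[OF r] by (intro mult_right_mono) auto
    also have "\<dots> = s / 2" by (simp add: s_def d_def power2_eq_square)
    finally show ?thesis .
  qed
  \<comment> \<open>S misses at most \<open>bump_const r * h\<close> \<le> s/2 of any window of
    length s. The right end \<open>A + d\<close> belongs to the next cell and is discarded as a
    single point.\<close>
  have int: "s / 2 \<le> integral {x..x + s} g" if x: "A \<le> x" "x + s \<le> A + d" for x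
  proof -
    have "integral {x..x + s} g = integral {x..x + s} (indicator S)"
    proof (rule integral_spike[of "{A + d}"])
      fix y assume "y \<in> {x..x + s} - {A + d}"
      then have "y \<in> J k0" using x by (auto simp: J_def A_def algebra_simps)
      then show "indicator S y = g y" using g_eq k0(1) c by simp
    qed auto
    also have "\<dots> = measure lebesgue (S \<inter> {x..x + s})"
      by (rule integral_indicator_Icc[OF S(1)])
    also have "\<dots> \<ge> s - bump_const r * (b - a)"
      using measure_Int_ge_of_dense[OF S(1) S' S(3), of x "x + s"] x A ab s by simp
    finally show ?thesis using ch by (simp add: h_def)
  qed
  obtain r' where r': "r = Suc r'" using r by (cases r) auto
  have "A + real r * s \<le> A + d" using rs s by (simp add: algebra_simps)
  then have ge: "s ^ r / 2 \<le> fdiff r s (iint r g) A"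
    using fdiff_iint_ge[OF g s, of A "A + d" A r', OF _ int] A ab by (simp add: r' del: iint.simps)
  \<comment> \<open>If all \<open>r + 1\<close> nodes stayed below this threshold,
    \<open>fdiff_less\<close> would contradict \<open>ge\<close>.\<close>
  define m where "m = s ^ r / 2 ^ (r + 1)"
  have "\<not> (\<forall>i\<le>r. \<bar>iint r g (A + real i * s)\<bar> < m)"
  proof
    assume "\<forall>i\<le>r. \<bar>iint r g (A + real i * s)\<bar> < m"
    then have "\<bar>fdiff r s (iint r g) A\<bar> < 2 ^ r * m" by (intro fdiff_less) auto
    also have "2 ^ r * m = s ^ r / 2" by (simp add: m_def)
    finally show False using ge by linarith
  qed
  then obtain i where i: "i \<le> r" "m \<le> \<bar>iint r g (A + real i * s)\<bar>" by (meson not_le)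
  define x0 where "x0 = A + real i * s"
  have "real i * s \<le> (real r + 1) * s" using i s by (intro mult_right_mono) auto
  then have x0: "a \<le> x0" "x0 \<le> b" "m \<le> \<bar>iint r g x0\<bar>"
    using i A s rs by (auto simp: x0_def intro!: add_increasing2)
  have lip: "\<bar>iint r g y - iint r g x\<bar> \<le> h ^ r' * (y - x)" if "a \<le> x" "x \<le> y" "y \<le> b" for x y
    using iint_Lipschitz[OF g g1 ga ab(1) that, of r'] by (simp add: r' h_def)
  have zl: "iint k g x = 0" if "1 \<le> k" "x \<le> a" for k x
    using iint_zero_left[of a g x "k - 1", OF ga] that by (simp del: iint.simps)
  have zr: "iint k g x = 0" if "k \<le> r" "b \<le> x" for k x
    using iint_zero_right[OF g gb' gb] that ab by auto
  define \<eta> where "\<eta> = bump_const r * h"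
  have \<eta>: "\<eta> > 0" using bump_const(1) h by (simp add: \<eta>_def)
  have "s = h / (real r + 1)\<^sup>2" by (simp add: s_def d_def power2_eq_square)
  then have "s ^ r = h ^ r / (real r + 1) ^ (2 * r)" by (simp add: power_divide power_mult)
  then have m\<eta>: "m = 2 * (h ^ r' * \<eta>)" "m = 2 * (bump_const r * h ^ r)"
    by (auto simp: m_def \<eta>_def bump_const_def r')
  \<comment> \<open>The \<open>r\<close>-fold integral is zero at a and at b, so climbing to m with
    Lipschitz constant \<open>h ^ r'\<close> takes at least the distance 2\<eta> on either
    side.\<close>
  have "2 * (h ^ r' * \<eta>) \<le> h ^ r' * (x0 - a)"
    using lip[of a x0] x0 zl[of r a] r m\<eta> by auto
  then have x0a: "2 * \<eta> \<le> x0 - a" using h by (simp add: mult.left_commute[of 2])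
  have "2 * (h ^ r' * \<eta>) \<le> h ^ r' * (b - x0)"
    using lip[of x0 b] x0 zr[of r b] r m\<eta> by auto
  then have x0b: "2 * \<eta> \<le> b - x0" using h by (simp add: mult.left_commute[of 2])
  \<comment> \<open>Within \<eta> of \<open>x0\<close> the modulus drops by at most half of m, and S
    misses at most \<eta> of this window of length 2\<eta>.\<close>
  define T where "T = S \<inter> {x0 - \<eta>..x0 + \<eta>}"
  have "measure lebesgue T \<ge> 2 * \<eta> - bump_const r * (b - a)"
    using measure_Int_ge_of_dense[OF S(1) S' S(3), of "x0 - \<eta>" "x0 + \<eta>"] x0a x0b ab \<eta> by (simp add: T_def)
  then have T: "measure lebesgue T \<ge> bump_const r * (b - a)" by (simp add: \<eta>_def h_def)
  have fT: "\<bar>iint r g x\<bar> \<ge> bump_const r * (b - a) ^ r" if "x \<in> T" for x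
  proof -
    have "\<bar>iint r g x - iint r g x0\<bar> \<le> h ^ r' * \<bar>x - x0\<bar>"
      using lip[of x x0] lip[of x0 x] that x0a x0b \<eta> by (cases "x \<le> x0") (auto simp: T_def abs_minus_commute)
    also have "\<dots> \<le> h ^ r' * \<eta>" using that h by (intro mult_left_mono) (auto simp: T_def abs_le_iff)
    finally have "\<bar>iint r g x0\<bar> - \<bar>iint r g x\<bar> \<le> h ^ r' * \<eta>" by linarith
    then show ?thesis using x0(3) m\<eta> unfolding h_def by linarith
  qed
  show ?thesis
  proof (rule that[OF g g1 gS _ _ _ T fT])
    show "iint k g x = 0" if "1 \<le> k" "k \<le> r" "x \<le> a \<or> b \<le> x" for k x
      using that zl zr by auto
  qed (use S in \<open>auto simp: T_def\<close>)
qed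

section \<open>Weighted norms on the half-line\<close>

abbreviation LD :: "real measure" where "LD \<equiv> lebesgue_on {0..}"

lemma epowr_ennreal: "0 \<le> x \<Longrightarrow> epowr (ennreal x) s = ennreal (x powr s)"
  by (simp add: epowr_def)

lemma epowr_top: "epowr top s = top"
  by (simp add: epowr_def)

lemma epowr_mono:
  assumes "x \<le> y" "0 < s" shows "epowr x s \<le> epowr y s"
proof (cases y)
  case (real b)
  then obtain a where "x = ennreal a" "0 \<le> a" using assms(1) by (cases x) (auto simp: top_unique)
  then show ?thesis using real assms by (simp add: epowr_ennreal ennreal_leI powr_mono2)
qed (simp add: epowr_top)

lemma epowr_inverse: "0 < s \<Longrightarrow> epowr (epowr x s) (1 / s) = x"
  by (cases x) (simp_all add: epowr_top epowr_ennreal powr_powr)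

lemma epowr_strict_mono:
  assumes "x < y" "0 < s" shows "epowr x s < epowr y s"
proof -
  have "epowr x s \<noteq> epowr y s" using assms epowr_inverse[of s] by (metis less_irrefl)
  moreover have "epowr x s \<le> epowr y s" using assms by (intro epowr_mono) auto
  ultimately show ?thesis by (simp add: less_le)
qed

lemma exponent_finite:
  assumes "1 \<le> (p::ennreal)" "p \<noteq> \<infinity>"
  shows "1 \<le> enn2real p" "inv_exp p = 1 / enn2real p" "ennreal (enn2real p) = p"
proof -
  show "inv_exp p = 1 / enn2real p" "ennreal (enn2real p) = p" using assms by (auto simp: inv_exp_def less_top)
  then show "1 \<le> enn2real p" using assms by (metis enn2real_1 enn2real_mono infinity_ennreal_def less_top)
qed

lemma Lnorm_cong_AE:
  assumes "AE x in LD. f x = g x" shows "Lnorm p f = Lnorm p g"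
proof -
  have "(AE x in LD. ennreal \<bar>f x\<bar> \<le> C) \<longleftrightarrow> (AE x in LD. ennreal \<bar>g x\<bar> \<le> C)" for C
    using assms by (auto elim: eventually_elim2)
  moreover have "(\<integral>\<^sup>+ x. ennreal (\<bar>f x\<bar> powr s) \<partial>LD) = (\<integral>\<^sup>+ x. ennreal (\<bar>g x\<bar> powr s) \<partial>LD)" for s
    using assms by (intro nn_integral_cong_AE) auto
  ultimately show ?thesis by (simp add: Lnorm_def)
qed

lemma Lnorm_one: "Lnorm 1 f = (\<integral>\<^sup>+ x. ennreal \<bar>f x\<bar> \<partial>LD)"
  by (simp add: Lnorm_def epowr_def less_top)

lemma nn_integral_step_fun:
  assumes "finite I" "\<And>i. i \<in> I \<Longrightarrow> T i \<in> sets lebesgue" "\<And>i. i \<in> I \<Longrightarrow> T i \<subseteq> {0..}"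
  shows "(\<integral>\<^sup>+ x. (\<Sum>i\<in>I. ennreal (c i) * indicator (T i) x) \<partial>LD) = (\<Sum>i\<in>I. ennreal (c i) * emeasure lebesgue (T i))"
proof -
  have T: "T i \<in> sets LD" if "i \<in> I" for i
    using assms(2,3)[OF that] by (subst sets_restrict_space_iff) auto
  have "(\<integral>\<^sup>+ x. (\<Sum>i\<in>I. ennreal (c i) * indicator (T i) x) \<partial>LD)
      = (\<Sum>i\<in>I. \<integral>\<^sup>+ x. ennreal (c i) * indicator (T i) x \<partial>LD)"
    using T by (intro nn_integral_sum borel_measurable_times_ennreal borel_measurable_indicator) auto
  also have "\<dots> = (\<Sum>i\<in>I. ennreal (c i) * emeasure LD (T i))"
    using T by (intro sum.cong nn_integral_cmult_indicator refl)
  also have "\<dots> = (\<Sum>i\<in>I. ennreal (c i) * emeasure lebesgue (T i))"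
    using assms by (intro sum.cong refl arg_cong2[where f=times] emeasure_restrict_space) auto
  finally show ?thesis .
qed

text \<open>By disjointness at most one summand is active at each point, so the step function with
  height \<open>c i\<close> on \<open>T i\<close> lies below the modulus of h, and its norm is a
  weighted sum of powers.\<close>

lemma Lnorm_sum_lower:
  assumes q: "1 \<le> q" "q \<noteq> \<infinity>" and I: "finite I" "disjoint_family_on T I"
    and T: "\<And>i. i \<in> I \<Longrightarrow> T i \<in> sets lebesgue" "\<And>i. i \<in> I \<Longrightarrow> T i \<subseteq> {0..}"
      "\<And>i. i \<in> I \<Longrightarrow> ennreal (m i) \<le> emeasure lebesgue (T i)"
    and c: "\<And>i x. i \<in> I \<Longrightarrow> x \<in> T i \<Longrightarrow> c i \<le> \<bar>h x\<bar>"
    and nonneg: "\<And>i. i \<in> I \<Longrightarrow> 0 \<le> c i" "\<And>i. i \<in> I \<Longrightarrow> 0 \<le> m i"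
  shows "ennreal ((\<Sum>i\<in>I. c i powr enn2real q * m i) powr inv_exp q) \<le> Lnorm q h"
proof -
  let ?q = "enn2real q"
  note qf = exponent_finite[OF q]
  have "ennreal (\<Sum>i\<in>I. c i powr ?q * m i) = (\<Sum>i\<in>I. ennreal (c i powr ?q) * ennreal (m i))"
    using nonneg by (simp add: ennreal_mult[symmetric] sum_ennreal)
  also have "\<dots> \<le> (\<Sum>i\<in>I. ennreal (c i powr ?q) * emeasure lebesgue (T i))"
    using T by (intro sum_mono mult_left_mono) auto
  also have "\<dots> = (\<integral>\<^sup>+ x. (\<Sum>i\<in>I. ennreal (c i powr ?q) * indicator (T i) x) \<partial>LD)"
    using T I by (intro nn_integral_step_fun[symmetric])
  also have "\<dots> \<le> (\<integral>\<^sup>+ x. ennreal (\<bar>h x\<bar> powr ?q) \<partial>LD)"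
  proof (rule nn_integral_mono)
    fix x
    show "(\<Sum>i\<in>I. ennreal (c i powr ?q) * indicator (T i) x) \<le> ennreal (\<bar>h x\<bar> powr ?q)"
    proof (cases "\<exists>j\<in>I. x \<in> T j")
      case True
      then obtain j where j: "j \<in> I" "x \<in> T j" by auto
      have "(\<Sum>i\<in>I. ennreal (c i powr ?q) * indicator (T i) x) = (\<Sum>i\<in>I. if i = j then ennreal (c j powr ?q) else 0)"
        using j I(2) by (intro sum.cong) (auto simp: disjoint_family_on_def indicator_def)
      then show ?thesis using j c[OF j] nonneg qf I by (auto intro!: ennreal_leI powr_mono2)
    qed (auto simp: indicator_def intro: sum.neutral)
  qed
  finally have "epowr (ennreal (\<Sum>i\<in>I. c i powr ?q * m i)) (1 / ?q) \<le> Lnorm q h"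
    using q qf by (auto simp: Lnorm_def intro!: epowr_mono)
  moreover have "0 \<le> (\<Sum>i\<in>I. c i powr ?q * m i)" using nonneg by (intro sum_nonneg) auto
  ultimately show ?thesis by (simp add: epowr_ennreal qf)
qed

text \<open>\<open>0 < m\<close> makes T non-null, so the essential supremum sees it, and gives
  \<open>m powr 0 = 1\<close>, the correct factor for infinite q.\<close>

lemma Lnorm_lower:
  assumes q: "1 \<le> q"
    and T: "T \<in> sets lebesgue" "T \<subseteq> {0..}" "ennreal m \<le> emeasure lebesgue T"
    and c: "\<And>x. x \<in> T \<Longrightarrow> c \<le> \<bar>h x\<bar>" and nonneg: "0 \<le> c" "0 < m"
  shows "ennreal (c * m powr inv_exp q) \<le> Lnorm q h"
proof (cases "q = \<infinity>")
  case True
  have "ennreal c \<le> C" if C: "AE x in LD. ennreal \<bar>h x\<bar> \<le> C" for C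
  proof (rule ccontr)
    assume "\<not> ennreal c \<le> C"
    then have "AE x in LD. x \<notin> T"
      using c by (intro eventually_mono[OF C]) (meson order_trans ennreal_leI)
    then have "AE x in lebesgue. x \<notin> T" using T(2) by (auto simp: AE_restrict_space_iff)
    then have "emeasure lebesgue T = 0" using T(1) by (simp add: AE_iff_measurable[OF _ refl])
    then show False using T(3) nonneg by simp
  qed
  then show ?thesis using True nonneg by (auto simp: Lnorm_def inv_exp_def intro!: Inf_greatest)
next
  case False
  have "(c powr enn2real q * m) powr inv_exp q = c * m powr inv_exp q"
    using exponent_finite[OF q False] nonneg by (simp add: powr_mult powr_powr)
  then show ?thesis
    using Lnorm_sum_lower[OF q False, of "{()}" "\<lambda>_. T" "\<lambda>_. m" "\<lambda>_. c" h] assms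
    by (simp add: disjoint_family_on_def)
qed

lemma Lnorm_sum_upper:
  assumes p: "1 \<le> p" "p \<noteq> \<infinity>" and I: "finite I"
    and S: "\<And>i. i \<in> I \<Longrightarrow> S i \<in> sets lebesgue" "\<And>i. i \<in> I \<Longrightarrow> S i \<subseteq> {0..}"
      "\<And>i. i \<in> I \<Longrightarrow> emeasure lebesgue (S i) \<le> ennreal (m i)"
    and c: "\<And>i x. i \<in> I \<Longrightarrow> x \<in> S i \<Longrightarrow> \<bar>h x\<bar> \<le> c i" "\<And>x. x \<notin> (\<Union>i\<in>I. S i) \<Longrightarrow> h x = 0"
    and nonneg: "\<And>i. i \<in> I \<Longrightarrow> 0 \<le> c i" "\<And>i. i \<in> I \<Longrightarrow> 0 \<le> m i"
  shows "Lnorm p h \<le> ennreal ((\<Sum>i\<in>I. c i powr enn2real p * m i) powr inv_exp p)"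
proof -
  let ?p = "enn2real p"
  note pf = exponent_finite[OF p]
  have "(\<integral>\<^sup>+ x. ennreal (\<bar>h x\<bar> powr ?p) \<partial>LD) \<le> (\<integral>\<^sup>+ x. (\<Sum>i\<in>I. ennreal (c i powr ?p) * indicator (S i) x) \<partial>LD)"
  proof (rule nn_integral_mono)
    fix x
    show "ennreal (\<bar>h x\<bar> powr ?p) \<le> (\<Sum>i\<in>I. ennreal (c i powr ?p) * indicator (S i) x)"
    proof (cases "\<exists>j\<in>I. x \<in> S j")
      case True
      then obtain j where j: "j \<in> I" "x \<in> S j" by auto
      have "ennreal (\<bar>h x\<bar> powr ?p) \<le> ennreal (c j powr ?p) * indicator (S j) x"
        using j c(1)[OF j] pf by (auto intro!: ennreal_leI powr_mono2)
      also have "\<dots> \<le> (\<Sum>i\<in>I. ennreal (c i powr ?p) * indicator (S i) x)"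
        using j I by (intro member_le_sum) auto
      finally show ?thesis .
    qed (use c(2) in auto)
  qed
  also have "\<dots> = (\<Sum>i\<in>I. ennreal (c i powr ?p) * emeasure lebesgue (S i))"
    using S I by (intro nn_integral_step_fun)
  also have "\<dots> \<le> (\<Sum>i\<in>I. ennreal (c i powr ?p) * ennreal (m i))"
    using S by (intro sum_mono mult_left_mono) auto
  also have "\<dots> = ennreal (\<Sum>i\<in>I. c i powr ?p * m i)"
    using nonneg by (simp add: ennreal_mult[symmetric] sum_ennreal)
  finally have "Lnorm p h \<le> epowr (ennreal (\<Sum>i\<in>I. c i powr ?p * m i)) (1 / ?p)"
    using p pf by (auto simp: Lnorm_def intro!: epowr_mono)
  moreover have "0 \<le> (\<Sum>i\<in>I. c i powr ?p * m i)" using nonneg by (intro sum_nonneg) auto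
  ultimately show ?thesis by (simp add: epowr_ennreal pf)
qed

lemma Lnorm_infinity_le:
  assumes "\<And>x. 0 \<le> x \<Longrightarrow> \<bar>h x\<bar> \<le> c"
  shows "Lnorm \<infinity> h \<le> ennreal c"
proof -
  have "AE x in LD. ennreal \<bar>h x\<bar> \<le> ennreal c" using assms by (intro AE_I2 ennreal_leI) auto
  then show ?thesis by (simp add: Lnorm_def Inf_lower)
qed

lemma Lnorm_upper:
  assumes p: "1 \<le> p" and S: "S \<in> sets lebesgue" "S \<subseteq> {0..}" "emeasure lebesgue S \<le> ennreal m"
    and c: "\<And>x. x \<in> S \<Longrightarrow> \<bar>h x\<bar> \<le> c" "\<And>x. x \<notin> S \<Longrightarrow> h x = 0" and nonneg: "0 \<le> c" "0 < m"
  shows "Lnorm p h \<le> ennreal (c * m powr inv_exp p)"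
proof (cases "p = \<infinity>")
  case True
  have "\<bar>h x\<bar> \<le> c" for x using c nonneg by (cases "x \<in> S") auto
  then show ?thesis using Lnorm_infinity_le[of h c] True nonneg by (simp add: inv_exp_def)
next
  case False
  have "(c powr enn2real p * m) powr inv_exp p = c * m powr inv_exp p"
    using exponent_finite[OF p False] nonneg by (simp add: powr_mult powr_powr)
  then show ?thesis
    using Lnorm_sum_upper[OF p False, of "{()}" "\<lambda>_. S" "\<lambda>_. m" h "\<lambda>_. c"] assms by simp
qed

lemma Lnorm_eq_0_AE:
  assumes "Lnorm p h = 0" "1 \<le> p" "h \<in> borel_measurable LD"
  shows "AE x in LD. h x = 0"
proof (cases "p = \<infinity>")
  case True
  have "AE x in LD. ennreal \<bar>h x\<bar> \<le> ennreal (1 / real (Suc n))" for n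
  proof -
    have "Inf {C. AE x in LD. ennreal \<bar>h x\<bar> \<le> C} < ennreal (1 / real (Suc n))"
      using assms(1) True by (simp add: Lnorm_def)
    then obtain C where C: "AE x in LD. ennreal \<bar>h x\<bar> \<le> C" "C < ennreal (1 / real (Suc n))"
      by (auto simp: Inf_less_iff)
    show ?thesis by (rule eventually_mono[OF C(1)]) (use C(2) in \<open>meson order_trans less_imp_le\<close>)
  qed
  then have "AE x in LD. \<forall>n. ennreal \<bar>h x\<bar> \<le> ennreal (1 / real (Suc n))" by (simp add: AE_all_countable)
  then show ?thesis
  proof eventually_elim
    case (elim x)
    then have "\<bar>h x\<bar> \<le> 1 / real (Suc n)" for n by (subst (asm) ennreal_le_iff) auto
    then show ?case using nat_approx_posE[of "\<bar>h x\<bar>"] by (metis not_le zero_less_abs_iff)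
  qed
next
  case False
  note pf = exponent_finite[OF assms(2) False]
  have "(\<integral>\<^sup>+ x. ennreal (\<bar>h x\<bar> powr enn2real p) \<partial>LD) = 0"
    using assms(1) False pf epowr_inverse[of "1 / enn2real p"]
    by (auto simp: Lnorm_def epowr_def enn2real_eq_0_iff split: if_splits)
  then show ?thesis using assms(3) by (subst (asm) nn_integral_0_iff_AE) auto
qed

text \<open>The q-th power of the maximum is at most the sum of the q-th powers, which costs a
  factor 2 to the power 1/q; this is rounded up to 2 so that the constant is uniform in q.\<close>

lemma Lnorm_le_max:
  assumes q: "1 \<le> q" and meas: "u \<in> borel_measurable LD" "v \<in> borel_measurable LD"
    and le: "\<And>x. 0 \<le> x \<Longrightarrow> \<bar>h x\<bar> \<le> max \<bar>u x\<bar> \<bar>v x\<bar>"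
  shows "Lnorm q h \<le> 2 * max (Lnorm q u) (Lnorm q v)"
proof (cases "q = \<infinity>")
  case True
  have *: "Lnorm q h \<le> max C D" if C: "AE x in LD. ennreal \<bar>u x\<bar> \<le> C" "AE x in LD. ennreal \<bar>v x\<bar> \<le> D" for C D
  proof -
    have "AE x in LD. ennreal \<bar>h x\<bar> \<le> max C D"
      using C AE_space
    proof eventually_elim
      case (elim x)
      then have "ennreal \<bar>h x\<bar> \<le> ennreal (max \<bar>u x\<bar> \<bar>v x\<bar>)" using le by (intro ennreal_leI) auto
      also have "\<dots> \<le> max C D" using elim by (auto simp: max_def)
      finally show ?case .
    qed
    then show ?thesis using True by (auto simp: Lnorm_def intro: Inf_lower)
  qed
  have "Lnorm q h \<le> max (Lnorm q u) (Lnorm q v)"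
  proof (rule ccontr)
    assume "\<not> ?thesis"
    then obtain C D where "AE x in LD. ennreal \<bar>u x\<bar> \<le> C" "C < Lnorm q h"
        "AE x in LD. ennreal \<bar>v x\<bar> \<le> D" "D < Lnorm q h"
      using True by (auto simp: Lnorm_def[of _ u] Lnorm_def[of _ v] not_le Inf_less_iff)
    then show False using *[of C D] by (auto simp: max_def split: if_splits)
  qed
  also have "\<dots> \<le> 2 * max (Lnorm q u) (Lnorm q v)"
    using add_increasing[of x x x for x :: ennreal] by (simp only: mult_2 zero_le order_refl)
  finally show ?thesis .
next
  case False
  note qf = exponent_finite[OF q False]
  let ?q = "enn2real q"
  define I where "I h = (\<integral>\<^sup>+ x. ennreal (\<bar>h x\<bar> powr ?q) \<partial>LD)" for h :: "real \<Rightarrow> real"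
  have L: "Lnorm q h = epowr (I h) (1 / ?q)" for h using False by (simp add: Lnorm_def I_def)
  have "I h \<le> (\<integral>\<^sup>+ x. ennreal (\<bar>u x\<bar> powr ?q) + ennreal (\<bar>v x\<bar> powr ?q) \<partial>LD)"
    unfolding I_def
  proof (rule nn_integral_mono)
    fix x assume "x \<in> space LD"
    then have "\<bar>h x\<bar> powr ?q \<le> max \<bar>u x\<bar> \<bar>v x\<bar> powr ?q" using le qf by (intro powr_mono2) auto
    also have "\<dots> \<le> \<bar>u x\<bar> powr ?q + \<bar>v x\<bar> powr ?q" by (auto simp: max_def)
    finally show "ennreal (\<bar>h x\<bar> powr ?q) \<le> ennreal (\<bar>u x\<bar> powr ?q) + ennreal (\<bar>v x\<bar> powr ?q)"
      by (simp add: ennreal_leI flip: ennreal_plus)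
  qed
  also have "\<dots> = I u + I v" unfolding I_def using meas by (intro nn_integral_add) auto
  also have "\<dots> \<le> 2 * max (I u) (I v)" by (simp add: mult_2 add_mono)
  finally have "Lnorm q h \<le> epowr (2 * max (I u) (I v)) (1 / ?q)" unfolding L using qf by (intro epowr_mono) auto
  also have "\<dots> \<le> 2 * epowr (max (I u) (I v)) (1 / ?q)"
  proof (cases "max (I u) (I v)")
    case (real M)
    have "2 powr (1 / ?q) \<le> 2 powr 1" using qf by (intro powr_mono) auto
    then have "(2 * M) powr (1 / ?q) \<le> 2 * M powr (1 / ?q)"
      using real by (simp add: powr_mult mult_right_mono)
    moreover have "2 * ennreal M = ennreal (2 * M)" using real by (simp add: ennreal_mult)
    moreover have "2 * ennreal (M powr (1 / ?q)) = ennreal (2 * M powr (1 / ?q))" by (simp add: ennreal_mult)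
    ultimately show ?thesis using real by (simp add: epowr_ennreal ennreal_leI)
  qed (simp add: epowr_def ennreal_mult_top)
  also have "epowr (max (I u) (I v)) (1 / ?q) \<le> max (Lnorm q u) (Lnorm q v)"
    unfolding L by (simp add: max_def) (use qf in \<open>auto intro: epowr_mono\<close>)
  finally show ?thesis by (simp add: mult_left_mono)
qed

section \<open>Fooling functions\<close>

lemma at_within_Ici_ne_bot: "0 \<le> x \<Longrightarrow> at x within {0::real..} \<noteq> bot"
proof -
  assume "0 \<le> x"
  then have "x islimpt {0..}"
    by (intro islimpt_subset[OF islimpt_greaterThanLessThan1[of x "x + 1"]]) auto
  then show ?thesis by (simp add: trivial_limit_within)
qed

text \<open>Iterated \<open>Dw\<close> is under control only on the half-line, so \<open>f'\<close>
  is compared there with a function f that is differentiable at x from both sides. Here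
  \<open>f'\<close> is a second function, not the derivative of f.\<close>

lemma Dw_of_DERIV:
  assumes "0 \<le> x" "(f has_real_derivative D) (at x)" "\<And>y. 0 \<le> y \<Longrightarrow> f' y = f y"
  shows "(f' has_vector_derivative D) (at x within {0..})" "Dw f' x = D"
proof -
  have "(f has_vector_derivative D) (at x within {0..})"
    using assms(2) by (simp add: has_real_derivative_iff_has_vector_derivative has_vector_derivative_at_within)
  then show *: "(f' has_vector_derivative D) (at x within {0..})"
    by (rule has_vector_derivative_transform[rotated 2]) (use assms in auto)
  show "Dw f' x = D"
    unfolding Dw_def by (rule vector_derivative_within[OF at_within_Ici_ne_bot[OF assms(1)] *])
qed

lemma Dw_iint:
  assumes "bdd_meas g" "j < r" "0 \<le> x"
  shows "(Dw ^^ j) (iint r g) x = iint (r - j) g x"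
  using assms(2,3)
proof (induction j arbitrary: x)
  case (Suc j)
  then have "r - j = Suc (Suc (r - Suc j - 1))" "r - Suc j = Suc (r - Suc j - 1)" by auto
  then have "(iint (r - j) g has_real_derivative iint (r - Suc j) g x) (at x)"
    using DERIV_iint[OF assms(1)] by metis
  then show ?case using Dw_of_DERIV(2)[of x "iint (r - j) g" _ "(Dw ^^ j) (iint r g)"] Suc by simp
qed simp

text \<open>The derivatives of lower order are known at every point, but the last one differentiates
  the integral of a merely measurable function. It recovers g only almost everywhere, which the
  norms do not notice.\<close>

lemma AE_Dw_iint:
  assumes "bdd_meas g" "1 \<le> r"
  shows "AE x in lebesgue_on {0..}. (Dw ^^ r) (iint r g) x = g x"
proof -
  obtain r' where r: "r = Suc r'" using assms(2) by (cases r) auto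
  have "AE x in lebesgue. x \<in> {0..} \<longrightarrow> (Dw ^^ r) (iint r g) x = g x"
    using AE_DERIV_iint[OF assms(1)]
  proof eventually_elim
    case (elim x)
    have "0 \<le> y \<Longrightarrow> (Dw ^^ r') (iint r g) y = iint 1 g y" for y
      using Dw_iint[OF assms(1), of r' r y] r by simp
    then show ?case using Dw_of_DERIV(2)[OF _ elim, of "(Dw ^^ r') (iint r g)"] r by auto
  qed
  then show ?thesis by (subst AE_restrict_space_iff) auto
qed

lemma loc_abs_cont_iint:
  assumes g: "bdd_meas g" and f: "\<And>x. 0 \<le> x \<Longrightarrow> f x = iint 1 g x"
  shows "loc_abs_cont_D f"
  unfolding loc_abs_cont_D_def
proof (intro allI impI)
  fix b \<epsilon> :: real assume "b \<ge> 0" "\<epsilon> > 0"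
  obtain B where B: "\<And>x. \<bar>g x\<bar> \<le> B" using g by (auto simp: bdd_meas_def)
  then have B0: "0 \<le> B" by (meson abs_ge_zero order_trans)
  have lip: "\<bar>f y - f x\<bar> \<le> B * (y - x)" if "0 \<le> x" "x \<le> y" for x y
  proof -
    have "\<bar>integral {x..y} g\<bar> \<le> integral {x..y} (\<lambda>_. B)"
      using B bdd_meas_int[OF g]
      by (intro Henstock_Kurzweil_Integration.integral_norm_bound_integral[where 'a=real, unfolded real_norm_def]) auto
    then show ?thesis using that iint_diff_eq[OF g, of x y 0] f by (simp add: mult.commute)
  qed
  show "\<exists>\<delta>>0. \<forall>(m::nat) a c.
        (\<forall>k<m. 0 \<le> a k \<and> a k \<le> c k \<and> c k \<le> b) \<and>
        (\<forall>k<m. \<forall>l<m. k \<noteq> l \<longrightarrow> c k \<le> a l \<or> c l \<le> a k) \<and>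
        (\<Sum>k<m. c k - a k) < \<delta>
        \<longrightarrow> (\<Sum>k<m. \<bar>f (c k) - f (a k)\<bar>) < \<epsilon>"
  proof (intro exI[of _ "\<epsilon> / (B + 1)"] conjI allI impI)
    show "0 < \<epsilon> / (B + 1)" using \<open>\<epsilon> > 0\<close> B0 by auto
    fix m :: nat and a c :: "nat \<Rightarrow> real"
    assume *: "(\<forall>k<m. 0 \<le> a k \<and> a k \<le> c k \<and> c k \<le> b) \<and>
        (\<forall>k<m. \<forall>l<m. k \<noteq> l \<longrightarrow> c k \<le> a l \<or> c l \<le> a k) \<and>
        (\<Sum>k<m. c k - a k) < \<epsilon> / (B + 1)"
    have "(\<Sum>k<m. \<bar>f (c k) - f (a k)\<bar>) \<le> (\<Sum>k<m. B * (c k - a k))"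
      using * lip by (intro sum_mono) auto
    also have "\<dots> = B * (\<Sum>k<m. c k - a k)" by (simp add: sum_distrib_left)
    also have "\<dots> \<le> B * (\<epsilon> / (B + 1))" using * B0 by (intro mult_left_mono) auto
    also have "\<dots> < \<epsilon>" using B0 \<open>\<epsilon> > 0\<close> by (simp add: field_simps)
    finally show "(\<Sum>k<m. \<bar>f (c k) - f (a k)\<bar>) < \<epsilon>" .
  qed
qed

lemma in_F_iint:
  assumes g: "bdd_meas g" and r: "1 \<le> r" and fin: "Lnorm p (\<lambda>x. g x * \<psi> x) < \<infinity>"
  shows "in_F r p \<psi> (iint r g)" "Lnorm p (\<lambda>x. (Dw ^^ r) (iint r g) x * \<psi> x) = Lnorm p (\<lambda>x. g x * \<psi> x)"
proof -
  show eq: "Lnorm p (\<lambda>x. (Dw ^^ r) (iint r g) x * \<psi> x) = Lnorm p (\<lambda>x. g x * \<psi> x)"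
    using AE_Dw_iint[OF g r] by (intro Lnorm_cong_AE) (auto elim: eventually_mono)
  have "((Dw ^^ j) (iint r g) has_vector_derivative (Dw ^^ Suc j) (iint r g) x) (at x within {0..})"
    if "j + 1 < r" "0 \<le> x" for j x
  proof -
    have "r - j = Suc (Suc (r - Suc j - 1))" "r - Suc j = Suc (r - Suc j - 1)" using that by auto
    then have "(iint (r - j) g has_real_derivative iint (r - Suc j) g x) (at x)"
      using DERIV_iint[OF g] by metis
    then show ?thesis
      using Dw_of_DERIV(1)[of x "iint (r - j) g" _ "(Dw ^^ j) (iint r g)"] Dw_iint[OF g, of _ r] that
      by (simp del: funpow.simps)
  qed
  moreover have "loc_abs_cont_D ((Dw ^^ (r - 1)) (iint r g))"
    using Dw_iint[OF g, of "r - 1" r] r by (intro loc_abs_cont_iint[OF g]) auto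
  ultimately show "in_F r p \<psi> (iint r g)" using fin eq by (simp add: in_F_def del: funpow.simps)
qed

lemma bdd_meas_uminus: "bdd_meas g \<Longrightarrow> bdd_meas (\<lambda>x. - g x)"
  using bdd_meas_sum[of "{()}" "\<lambda>_. g" "\<lambda>_. - 1"] by simp

lemma iint_uminus: "bdd_meas g \<Longrightarrow> iint k (\<lambda>x. - g x) x = - iint k g x"
  using iint_sum[of "{()}" "\<lambda>_. g" k "\<lambda>_. - 1" x] by simp

lemma Lnorm_abs: "(\<And>x. \<bar>f x\<bar> = \<bar>g x\<bar>) \<Longrightarrow> Lnorm p f = Lnorm p g"
  by (simp add: Lnorm_def)

lemma continuous_on_iint: "bdd_meas g \<Longrightarrow> 1 \<le> k \<Longrightarrow> continuous_on S (iint k g)"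
  using isCont_iint[of g, where k="k - 1"] by (intro continuous_at_imp_continuous_on) (auto simp del: iint.simps)

text \<open>f and -f carry the same zero information on X, so A sends both to one function on the
  half-line. Pointwise, the modulus of f is then at most the larger of the two errors, whence the
  factor 2 via \<open>Lnorm_le_max\<close>.\<close>

lemma worst_err_ge_of_fooling_function:
  assumes r: "1 \<le> r" and p: "1 \<le> p" and q: "1 \<le> q"
    and \<psi>: "\<psi> \<in> borel_measurable LD" "\<And>x. 0 \<le> x \<Longrightarrow> 0 < \<psi> x" and \<rho>: "\<rho> \<in> borel_measurable LD"
    and info: "\<And>f g. in_F r p \<psi> f \<Longrightarrow> in_F r p \<psi> g \<Longrightarrow>
          (\<And>t j. t \<in> X \<Longrightarrow> j < r \<Longrightarrow> (Dw ^^ j) f t = (Dw ^^ j) g t) \<Longrightarrow> (\<And>x. 0 \<le> x \<Longrightarrow> A f x = A g x)"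
    and A_meas: "\<And>f. in_F r p \<psi> f \<Longrightarrow> A f \<in> borel_measurable LD"
    and g: "bdd_meas g" and X: "X \<subseteq> {0..}" "\<And>t k. t \<in> X \<Longrightarrow> 1 \<le> k \<Longrightarrow> k \<le> r \<Longrightarrow> iint k g t = 0"
    and M: "0 < M" "Lnorm p (\<lambda>x. g x * \<psi> x) \<le> ennreal M"
    and N: "0 < N" "ennreal N \<le> Lnorm q (\<lambda>x. iint r g x * \<rho> x)"
  shows "ennreal (N / (2 * M)) \<le> worst_err r p q \<psi> \<rho> A"
proof -
  define f where "f = iint r g"
  \<comment> \<open>The negative of f is introduced as an iterated integral so that
    \<open>in_F_iint\<close> and \<open>Dw_iint\<close> apply to it directly.\<close>
  define f' where "f' = iint r (\<lambda>x. - g x)"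
  have f': "f' x = - f x" for x using iint_uminus[OF g] by (simp add: f_def f'_def)
  have g': "bdd_meas (\<lambda>x. - g x)" using g by (rule bdd_meas_uminus)
  define D where "D = Lnorm p (\<lambda>x. g x * \<psi> x)"
  have D': "Lnorm p (\<lambda>x. - g x * \<psi> x) = D" unfolding D_def by (rule Lnorm_abs) simp
  have Dfin: "D < \<infinity>" using M(2) by (auto simp: D_def intro: le_less_trans)
  have f: "in_F r p \<psi> f" "Lnorm p (\<lambda>x. (Dw ^^ r) f x * \<psi> x) = D"
    using in_F_iint[OF g r, of p \<psi>] Dfin by (auto simp: f_def D_def)
  have f'F: "in_F r p \<psi> f'" "Lnorm p (\<lambda>x. (Dw ^^ r) f' x * \<psi> x) = D"
    using in_F_iint[OF g' r, of p \<psi>] Dfin D' by (auto simp: f'_def)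
  \<comment> \<open>The supremum in \<open>worst_err\<close> ranges over functions with nonzero
    denominator. If D were 0, g would vanish almost everywhere and all its integrals everywhere,
    contradicting N > 0.\<close>
  have "D \<noteq> 0"
  proof
    assume "D = 0"
    have "g \<in> borel_measurable LD" using g by (auto simp: bdd_meas_def intro: measurable_restrict_space1)
    then have "AE x in LD. g x * \<psi> x = 0"
      using Lnorm_eq_0_AE[of p "\<lambda>x. g x * \<psi> x"] \<open>D = 0\<close> p \<psi> by (auto simp: D_def)
    then have "AE x in lebesgue. x \<in> {0..} \<longrightarrow> g x * \<psi> x = 0" by (subst (asm) AE_restrict_space_iff) auto
    then have "AE x in lebesgue. g x = 0"
      using \<psi>(2) bdd_measD[OF g] by (elim eventually_mono) (metis atLeast_iff less_irrefl mult_eq_0_iff not_le)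
    then have "iint k g x = 0" if "k \<ge> 1" for k x
      using that
    proof (induction k arbitrary: x)
      case (Suc k)
      have "integral {0..x} (iint k g) = integral {0..x} (\<lambda>_. 0)"
      proof (cases k)
        case 0
        obtain N where "negligible N" "\<And>x. x \<notin> N \<Longrightarrow> g x = 0"
          using Suc.prems(1) by (auto elim!: AE_E3 simp: negligible_iff_null_sets)
        then show ?thesis using 0 by (intro integral_spike[of N]) auto
      qed (use Suc in \<open>auto intro!: Henstock_Kurzweil_Integration.integral_cong\<close>)
      then show ?case by simp
    qed simp
    then have "Lnorm q (\<lambda>x. iint r g x * \<rho> x) = Lnorm q (\<lambda>x. 0)" using r by simp
    also have "\<dots> = 0"
      using q by (auto simp: Lnorm_def epowr_def exponent_finite(1) bot_ennreal intro!: Inf_eqI)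
    finally show False using N by simp
  qed
  define u where "u x = (f x - A f x) * \<rho> x" for x
  define v where "v x = (f' x - A f' x) * \<rho> x" for x
  have A_eq: "A f x = A f' x" if "0 \<le> x" for x
  proof (rule info[OF f(1) f'F(1) _ that])
    fix t j assume t: "t \<in> X" "j < r"
    then show "(Dw ^^ j) f t = (Dw ^^ j) f' t"
      using Dw_iint[OF g] Dw_iint[OF g'] X iint_uminus[OF g] by (auto simp: f_def f'_def subset_iff)
  qed
  have "f \<in> borel_measurable LD" "f' \<in> borel_measurable LD"
    using continuous_on_iint[OF g r] continuous_on_iint[OF g' r] unfolding f_def f'_def
    by (auto intro!: continuous_imp_measurable_on_sets_lebesgue)
  then have "u \<in> borel_measurable LD" "v \<in> borel_measurable LD"
    using A_meas f(1) f'F(1) \<rho> by (auto simp: u_def[abs_def] v_def[abs_def])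
  moreover have "\<bar>f x * \<rho> x\<bar> \<le> max \<bar>u x\<bar> \<bar>v x\<bar>" if "0 \<le> x" for x
  proof -
    have "\<bar>f x\<bar> \<le> max \<bar>f x - A f x\<bar> \<bar>f' x - A f' x\<bar>" using A_eq[OF that] f'[of x] by (auto simp: max_def abs_if)
    then have "\<bar>f x\<bar> * \<bar>\<rho> x\<bar> \<le> max \<bar>f x - A f x\<bar> \<bar>f' x - A f' x\<bar> * \<bar>\<rho> x\<bar>" by (intro mult_right_mono) auto
    then show ?thesis by (simp add: u_def v_def abs_mult max_mult_distrib_right)
  qed
  ultimately have "Lnorm q (\<lambda>x. f x * \<rho> x) \<le> 2 * max (Lnorm q u) (Lnorm q v)"
    by (intro Lnorm_le_max[OF q])
  then have N': "ennreal N \<le> 2 * max (Lnorm q u) (Lnorm q v)" using N(2) by (simp add: f_def)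
  have W: "Lnorm q u / D \<le> worst_err r p q \<psi> \<rho> A"
    unfolding worst_err_def by (rule SUP_upper2[of f]) (use f \<open>D \<noteq> 0\<close> in \<open>simp_all add: u_def[abs_def]\<close>)
  have W': "Lnorm q v / D \<le> worst_err r p q \<psi> \<rho> A"
    unfolding worst_err_def by (rule SUP_upper2[of f']) (use f'F \<open>D \<noteq> 0\<close> in \<open>simp_all add: v_def[abs_def]\<close>)
  define m where "m = max (Lnorm q u) (Lnorm q v)"
  obtain d where d: "D = ennreal d" "0 < d" "d \<le> M"
    using M \<open>D \<noteq> 0\<close> by (cases D) (auto simp: D_def[symmetric] ennreal_eq_0_iff not_le top_unique)
  have "ennreal (N / (2 * M)) \<le> m / D"
  proof (cases m)
    case (real m')
    then have "2 * m = ennreal (2 * m')" by (simp add: ennreal_mult)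
    then have "N \<le> 2 * m'" using N' N(1) real(1) unfolding m_def[symmetric] by (simp del: ennreal_mult')
    then have "N / (2 * M) \<le> m' / d" using d N(1) M(1) by (auto intro!: frac_le[of "2 * m'" N "2 * d" "2 * M", simplified])
    then show ?thesis using real d by (simp add: divide_ennreal ennreal_leI)
  qed (use d in \<open>simp add: ennreal_top_divide\<close>)
  also have "\<dots> \<le> worst_err r p q \<psi> \<rho> A" using W W' by (simp add: m_def max_def)
  finally show ?thesis .
qed

section \<open>Knot intervals around density points\<close>

text \<open>The intervals need not be centred at x: the integral of the indicator has derivative 1
  at a density point, so E fills almost all of the part to the left of x and almost all of the part
  to the right of x separately.\<close>

lemma lebesgue_density:
  assumes E: "E \<in> sets lebesgue"
  shows "AE x in lebesgue. x \<in> E \<longrightarrow> (\<forall>\<epsilon>>0. \<exists>d>0. \<forall>a b. x - d < a \<longrightarrow> a \<le> x \<longrightarrow> x < b \<longrightarrow> b < x + d \<longrightarrow>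
      (1 - \<epsilon>) * (b - a) \<le> measure lebesgue (E \<inter> {a..<b}))"
proof -
  have int: "indicat_real E integrable_on {a..b}" for a b
  proof (rule measurable_bounded_by_integrable_imp_integrable_real[where g="\<lambda>_. 1"])
    show "indicat_real E \<in> borel_measurable (lebesgue_on {a..b})"
      using E by (intro measurable_restrict_space1 borel_measurable_indicator)
  qed auto
  show ?thesis
    using lebesgue_differentiation[OF int]
  proof (eventually_elim, intro impI allI)
    fix x \<epsilon> :: real
    assume D: "\<forall>c<x. ((\<lambda>t. integral {c..t} (indicat_real E)) has_real_derivative indicat_real E x) (at x)"
      and x: "x \<in> E" and \<epsilon>: "\<epsilon> > 0"
    define \<Phi> where "\<Phi> t = integral {x - 1..t} (indicat_real E)" for t
    have "(\<Phi> has_real_derivative 1) (at x)"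
      using D[rule_format, of "x - 1"] x by (simp add: \<Phi>_def[abs_def])
    then obtain d where d: "d > 0" "\<And>h. h \<noteq> 0 \<Longrightarrow> \<bar>h\<bar> < d \<Longrightarrow> \<bar>(\<Phi> (x + h) - \<Phi> x) / h - 1\<bar> < \<epsilon>"
      using \<epsilon> unfolding DERIV_def LIM_def by (auto simp: dist_real_def)
    show "\<exists>d>0. \<forall>a b. x - d < a \<longrightarrow> a \<le> x \<longrightarrow> x < b \<longrightarrow> b < x + d \<longrightarrow>
      (1 - \<epsilon>) * (b - a) \<le> measure lebesgue (E \<inter> {a..<b})"
    proof (intro exI[of _ "min d 1"] conjI allI impI)
      fix a b assume ab: "x - min d 1 < a" "a \<le> x" "x < b" "b < x + min d 1"
      have 1: "\<Phi> b - \<Phi> x \<ge> (1 - \<epsilon>) * (b - x)"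
      proof -
        have "\<bar>(\<Phi> (x + (b - x)) - \<Phi> x) / (b - x) - 1\<bar> < \<epsilon>" using ab by (intro d(2)) auto
        then have "1 - \<epsilon> < (\<Phi> b - \<Phi> x) / (b - x)" by (simp add: abs_less_iff)
        then show ?thesis using ab by (simp add: less_divide_eq)
      qed
      have 2: "\<Phi> x - \<Phi> a \<ge> (1 - \<epsilon>) * (x - a)"
      proof (cases "a = x")
        case False
        have "(\<Phi> x - \<Phi> a) / (x - a) > 1 - \<epsilon>"
        proof -
          have "\<bar>(\<Phi> (x + (a - x)) - \<Phi> x) / (a - x) - 1\<bar> < \<epsilon>" using ab False by (intro d(2)) auto
          moreover have "(\<Phi> (x + (a - x)) - \<Phi> x) / (a - x) = (\<Phi> x - \<Phi> a) / (x - a)"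
            using minus_divide_divide[of "\<Phi> a - \<Phi> x" "a - x"] by simp
          ultimately show ?thesis by (simp add: abs_less_iff)
        qed
        then show ?thesis using ab False by (simp add: less_divide_eq)
      qed simp
      have "\<Phi> b = \<Phi> a + integral {a..b} (indicat_real E)"
        using Henstock_Kurzweil_Integration.integral_combine[of "x - 1" a b "indicat_real E"] ab int
        by (simp add: \<Phi>_def)
      also have "integral {a..b} (indicat_real E) = integral {a..b} (indicat_real (E \<inter> {a..<b}))"
        by (rule integral_spike[of "{b}"]) (auto simp: indicator_def)
      also have "\<dots> = measure lebesgue (E \<inter> {a..<b})"
      proof -
        have "E \<inter> {a..<b} \<inter> {a..b} = E \<inter> {a..<b}" by auto
        moreover have "E \<inter> {a..<b} \<in> sets lebesgue" using E by (intro sets.Int) auto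
        ultimately show ?thesis using integral_indicator_Icc[of "E \<inter> {a..<b}" a b] by simp
      qed
      finally show "(1 - \<epsilon>) * (b - a) \<le> measure lebesgue (E \<inter> {a..<b})"
        using 1 2 by (simp add: algebra_simps)
    qed (use d in auto)
  qed
qed

lemma floor_log2_eq_bound:
  assumes "\<lfloor>log 2 s\<rfloor> = \<lfloor>log 2 t\<rfloor>" "0 < s" "0 < t"
  shows "s \<le> 2 * t"
proof -
  have "log 2 s < log 2 t + 1" using assms(1) by linarith
  also have "\<dots> = log 2 (2 * t)" using assms by (simp add: log_mult)
  finally show ?thesis using assms by simp
qed

section \<open>The weights, the knot density and its distribution function\<close>

locale sampling =
  fixes r :: nat and p q :: ennreal and \<psi> \<rho> \<kappa> :: "real \<Rightarrow> real"
  assumes r: "1 \<le> r" and p: "1 \<le> p" and q: "1 \<le> q" and alpha_pos: "0 < alpha r p q"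
    and \<psi>: "\<And>x. 0 \<le> x \<Longrightarrow> 0 < \<psi> x" "\<psi> \<in> borel_measurable LD"
    and \<rho>: "\<And>x. 0 \<le> x \<Longrightarrow> 0 < \<rho> x" "\<rho> \<in> borel_measurable LD"
    and \<kappa>: "\<And>x. 0 \<le> x \<Longrightarrow> 0 < \<kappa> x" "\<And>x y. 0 \<le> x \<Longrightarrow> x \<le> y \<Longrightarrow> \<kappa> y \<le> \<kappa> x"
    and fin: "Lnorm 1 (\<lambda>t. \<kappa> t powr (1 / alpha r p q)) < \<infinity>"
begin

abbreviation "\<alpha> \<equiv> alpha r p q"
definition K where "K x = \<kappa> x powr (1 / \<alpha>)"
definition F where "F t = integral {0..t} K"
definition L where "L = enn2real (Lnorm 1 K)"

lemma K_pos: "0 \<le> x \<Longrightarrow> 0 < K x" using \<kappa> by (simp add: K_def less_imp_neq[symmetric])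

lemma K_nonneg: "0 \<le> K x" by (simp add: K_def)

lemma K_antimono: "0 \<le> x \<Longrightarrow> x \<le> y \<Longrightarrow> K y \<le> K x"
  using \<kappa>(1)[of y] \<kappa>(2)[of x y] alpha_pos unfolding K_def by (intro powr_mono2) auto

lemma \<kappa>_meas: "\<kappa> \<in> borel_measurable LD"
proof -
  \<comment> \<open>Freezing \<kappa> at its value at 0 on the negative axis, with the sign
    reversed, gives a function that is monotone on the whole line.\<close>
  define k where "k x = - \<kappa> (max 0 x)" for x
  have "mono k" unfolding k_def by (intro monoI) (simp add: \<kappa> max_def)
  then have "k \<in> borel_measurable borel" by (rule borel_measurable_mono)
  then have "(\<lambda>x. - k x) \<in> borel_measurable LD"
    by (intro measurable_restrict_space1 borel_measurable_uminus measurable_completion) auto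
  then show ?thesis by (rule measurable_cong[THEN iffD1, rotated]) (auto simp: k_def max_def)
qed

lemma K_integrable: "integrable LD K"
proof (rule integrableI_bounded)
  show "K \<in> borel_measurable LD" unfolding K_def[abs_def] using \<kappa>_meas by measurable
  show "(\<integral>\<^sup>+ x. ennreal (norm (K x)) \<partial>LD) < \<infinity>" using fin by (simp add: K_def[abs_def] Lnorm_one)
qed

lemma Lnorm_K: "Lnorm 1 (\<lambda>t. \<kappa> t powr (1 / \<alpha>)) = ennreal L"
  using fin by (simp add: L_def K_def[abs_def] less_top)

lemma L_eq: "L = integral {0..} K"
proof -
  have "Lnorm 1 K = (\<integral>\<^sup>+ x. ennreal (K x) \<partial>LD)" by (simp add: Lnorm_one K_def)
  also have "\<dots> = ennreal (integral\<^sup>L LD K)" using K_integrable by (intro nn_integral_eq_integral) (auto simp: K_nonneg)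
  finally show ?thesis
    using K_integrable by (simp add: L_def lebesgue_integral_eq_integral[symmetric] integral_nonneg_AE K_nonneg)
qed

lemma K_integrable_on: "K integrable_on {0..}"
  using K_integrable by (intro integrable_on_lebesgue_on) auto

lemma K_int: "0 \<le> a \<Longrightarrow> K integrable_on {a..b}"
proof -
  assume "0 \<le> a"
  have "K absolutely_integrable_on {0..}"
    using K_integrable_on by (intro nonnegative_absolutely_integrable_1) (auto simp: K_nonneg)
  then have "K absolutely_integrable_on {a..b}"
    by (rule set_integrable_subset) (use \<open>0 \<le> a\<close> in auto)
  then show ?thesis by (simp add: absolutely_integrable_on_def)
qed

lemma F_le_L: "F t \<le> L"
  unfolding F_def L_eq using K_int K_integrable_on by (intro integral_subset_le) (auto simp: K_nonneg)

lemma nn_integral_K: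
  assumes "0 \<le> a"
  shows "(\<integral>\<^sup>+ s. ennreal (indicator {a..b} s * K s) \<partial>LD) = ennreal (integral {a..b} K)"
proof -
  have i: "integrable LD (\<lambda>s. indicator {a..b} s * K s)"
    using K_integrable assms by (intro integrable_real_mult_indicator[unfolded mult.commute[of _ "indicator _ _"]])
      (auto simp: sets_restrict_space_iff)
  have "(\<integral>\<^sup>+ s. ennreal (indicator {a..b} s * K s) \<partial>LD) = ennreal (integral\<^sup>L LD (\<lambda>s. indicator {a..b} s * K s))"
    using i by (intro nn_integral_eq_integral) (auto simp: K_nonneg)
  also have "integral\<^sup>L LD (\<lambda>s. indicator {a..b} s * K s) = integral {0..} (\<lambda>s. if s \<in> {a..b} then K s else 0)"
    using i by (subst lebesgue_integral_eq_integral) (auto intro!: Henstock_Kurzweil_Integration.integral_cong simp: indicator_def)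
  also have "\<dots> = integral ({a..b} \<inter> {0..}) K"
    by (rule Henstock_Kurzweil_Integration.integral_restrict_Int)
  also have "{a..b} \<inter> {0..} = {a..b}" using assms by auto
  finally show ?thesis .
qed

lemma Lnorm_indicator_K: "Lnorm 1 (\<lambda>s. indicator {0..t} s * \<kappa> s powr (1 / \<alpha>)) = ennreal (F t)"
  using nn_integral_K[of 0 t] by (simp add: Lnorm_one F_def K_def abs_mult)

lemma F_nonneg: "0 \<le> F t"
  unfolding F_def by (cases "0 \<le> t") (auto intro!: Henstock_Kurzweil_Integration.integral_nonneg K_int simp: K_def)

lemma L_nonneg: "0 \<le> L" by (simp add: L_def)

text \<open>Knots become quantiles of \<open>F\<close>, whose strict monotonicity then yields their
  uniqueness and order.\<close>

lemma is_knot_iff: "is_knot \<kappa> \<alpha> n t \<longleftrightarrow> 0 \<le> t \<and> (\<exists>i<n. F t = real i * L / real n)"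
proof (cases "0 \<le> t")
  case True
  have "ennreal (real i / real n) * ennreal L = ennreal (real i * L / real n)" for i
    using L_nonneg by (simp add: ennreal_mult[symmetric])
  then show ?thesis using True L_nonneg F_nonneg
    by (auto simp: is_knot_def Lnorm_indicator_K Lnorm_K simp del: ennreal_mult'')
qed (simp add: is_knot_def)

text \<open>The monotone \<open>K\<close> lies between its two end values. The upper bound makes
  knot intervals long where \<open>K\<close> is small; the lower bound makes \<open>F\<close>
  strictly increasing.\<close>

lemma F_diff:
  assumes "0 \<le> s" "s \<le> t" shows "F t - F s \<le> K s * (t - s)" "K t * (t - s) \<le> F t - F s"
proof -
  have eq: "F t - F s = integral {s..t} K"
    using Henstock_Kurzweil_Integration.integral_combine[of 0 s t K] K_int assms by (simp add: F_def)
  have "integral {s..t} K \<le> integral {s..t} (\<lambda>_. K s)"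
    using assms K_int K_antimono by (intro integral_le) auto
  then show "F t - F s \<le> K s * (t - s)" using eq assms by (simp add: mult.commute)
  have "integral {s..t} (\<lambda>_. K t) \<le> integral {s..t} K"
    using assms K_int K_antimono by (intro integral_le) auto
  then show "K t * (t - s) \<le> F t - F s" using eq assms by (simp add: mult.commute)
qed

lemma F_strict_mono: "0 \<le> s \<Longrightarrow> s < t \<Longrightarrow> F s < F t"
  using F_diff(2)[of s t] K_pos[of t] by (smt (verit) mult_pos_pos)

lemma F_mono: "0 \<le> s \<Longrightarrow> s \<le> t \<Longrightarrow> F s \<le> F t"
  using F_strict_mono[of s t] by (cases "s = t") auto

lemma F_inj: "0 \<le> s \<Longrightarrow> 0 \<le> t \<Longrightarrow> F s = F t \<Longrightarrow> s = t"
  using F_strict_mono by (metis linorder_neqE_linordered_idom less_irrefl)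

lemma F_less_L: "0 \<le> t \<Longrightarrow> F t < L"
  using F_strict_mono[of t "t + 1"] F_le_L[of "t + 1"] by simp

lemma F_0: "F 0 = 0" by (simp add: F_def)

lemma L_pos: "0 < L" using F_less_L[of 0] by (simp add: F_0)

lemma F_IVT:
  assumes "0 \<le> y" "y \<le> F t" "0 \<le> t" obtains s where "0 \<le> s" "s \<le> t" "F s = y"
proof -
  have "continuous_on {0..t} F" unfolding F_def[abs_def] by (rule indefinite_integral_continuous_1) (simp add: K_int)
  then show ?thesis using IVT'[of F 0 y t] assms that by (auto simp: F_0)
qed

section \<open>Dyadic level sets of the weights and the knot intervals they fill\<close>

definition E where "E x = {y. 0 \<le> y \<and> \<lfloor>log 2 (\<psi> y)\<rfloor> = \<lfloor>log 2 (\<psi> x)\<rfloor> \<and> \<lfloor>log 2 (\<rho> y)\<rfloor> = \<lfloor>log 2 (\<rho> x)\<rfloor>}"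

text \<open>\<open>i + 1 < n\<close> excludes the last interval, whose right end is
  infinite.\<close>

definition knot_interval where
  "knot_interval n i a b \<longleftrightarrow> 0 \<le> a \<and> a < b \<and> F a = real i * L / real n \<and> F b = (real i + 1) * L / real n \<and> i + 1 < n"

text \<open>The density is that of the level set of x itself, so two points of one interval may a
  priori refer to different sets. \<kappa> takes its maximum over the interval at a, so the last
  condition controls it throughout the interval.\<close>

definition good where
  "good n i a b x \<longleftrightarrow> knot_interval n i a b \<and> a \<le> x \<and> x < b \<and>
     (1 - bump_const r) * (b - a) \<le> measure lebesgue (E x \<inter> {a..<b}) \<and> \<kappa> a \<le> 2 * \<kappa> x"

lemma E_measurable: "E x \<in> sets lebesgue"
proof -
  have "{y \<in> space LD. \<lfloor>log 2 (\<psi> y)\<rfloor> = \<lfloor>log 2 (\<psi> x)\<rfloor> \<and> \<lfloor>log 2 (\<rho> y)\<rfloor> = \<lfloor>log 2 (\<rho> x)\<rfloor>} \<in> sets LD"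
    using \<psi> \<rho> by measurable
  also have "{y \<in> space LD. \<lfloor>log 2 (\<psi> y)\<rfloor> = \<lfloor>log 2 (\<psi> x)\<rfloor> \<and> \<lfloor>log 2 (\<rho> y)\<rfloor> = \<lfloor>log 2 (\<rho> x)\<rfloor>} = E x"
    by (auto simp: E_def)
  finally show ?thesis by (subst (asm) sets_restrict_space_iff) auto
qed

lemma E_bounds:
  assumes "y \<in> E x" "0 \<le> x"
  shows "\<psi> y \<le> 2 * \<psi> x" "\<psi> x \<le> 2 * \<psi> y" "\<rho> y \<le> 2 * \<rho> x" "\<rho> x \<le> 2 * \<rho> y"
  using assms \<psi>(1) \<rho>(1) by (auto simp: E_def intro!: floor_log2_eq_bound)

text \<open>\<open>E x\<close> varies with x, but takes only countably many values, indexed by pairs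
  of integers. The density theorem for each of them leaves a single null set.\<close>

lemma AE_dense_point:
  "AE x in lebesgue. 0 < x \<longrightarrow> (\<exists>d>0. \<forall>a b. x - d < a \<longrightarrow> a \<le> x \<longrightarrow> x < b \<longrightarrow> b < x + d \<longrightarrow>
      (1 - bump_const r) * (b - a) \<le> measure lebesgue (E x \<inter> {a..<b}))"
proof -
  define C where "C u v = {y. 0 \<le> y \<and> \<lfloor>log 2 (\<psi> y)\<rfloor> = u \<and> \<lfloor>log 2 (\<rho> y)\<rfloor> = v}" for u v
  have "C u v \<in> sets lebesgue" for u v
  proof -
    have "C u v = {} \<or> (\<exists>x. C u v = E x)" by (auto simp: C_def E_def)
    then show ?thesis using E_measurable by auto
  qed
  from lebesgue_density[OF this]
  have "AE x in lebesgue. \<forall>u v. x \<in> C u v \<longrightarrow> (\<forall>\<epsilon>>0. \<exists>d>0. \<forall>a b. x - d < a \<longrightarrow> a \<le> x \<longrightarrow> x < b \<longrightarrow> b < x + d \<longrightarrow>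
      (1 - \<epsilon>) * (b - a) \<le> measure lebesgue (C u v \<inter> {a..<b}))"
    by (simp only: AE_all_countable) auto
  then show ?thesis
  proof (elim eventually_mono, intro impI)
    fix x :: real
    assume *: "\<forall>u v. x \<in> C u v \<longrightarrow> (\<forall>\<epsilon>>0. \<exists>d>0. \<forall>a b. x - d < a \<longrightarrow> a \<le> x \<longrightarrow> x < b \<longrightarrow> b < x + d \<longrightarrow>
      (1 - \<epsilon>) * (b - a) \<le> measure lebesgue (C u v \<inter> {a..<b}))" and x: "0 < x"
    have "C \<lfloor>log 2 (\<psi> x)\<rfloor> \<lfloor>log 2 (\<rho> x)\<rfloor> = E x" by (auto simp: C_def E_def)
    moreover have "x \<in> C \<lfloor>log 2 (\<psi> x)\<rfloor> \<lfloor>log 2 (\<rho> x)\<rfloor>" using x by (auto simp: C_def)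
    ultimately show "\<exists>d>0. \<forall>a b. x - d < a \<longrightarrow> a \<le> x \<longrightarrow> x < b \<longrightarrow> b < x + d \<longrightarrow>
      (1 - bump_const r) * (b - a) \<le> measure lebesgue (E x \<inter> {a..<b})"
      using * bump_const(1) by metis
  qed
qed

text \<open>A monotone function has countably many discontinuities; elsewhere continuity with
  tolerance \<open>\<kappa> x\<close> gives the factor 2.\<close>

lemma AE_continuous_\<kappa>: "AE x in lebesgue. 0 < x \<longrightarrow> (\<exists>d>0. \<forall>a. x - d < a \<longrightarrow> 0 \<le> a \<longrightarrow> a \<le> x \<longrightarrow> \<kappa> a \<le> 2 * \<kappa> x)"
proof -
  have "mono_on {0..} (\<lambda>x. - \<kappa> x)" using \<kappa> by (auto intro!: mono_onI)
  then have "countable {a \<in> {0..}. \<not> continuous (at a within {0..}) (\<lambda>x. - \<kappa> x)}" (is "countable ?N")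
    by (rule mono_on_ctble_discont)
  then have "?N \<in> null_sets lebesgue" by (intro null_sets_completionI countable_imp_null_set_lborel)
  then have "AE x in lebesgue. x \<notin> ?N" by (rule AE_not_in)
  then show ?thesis
  proof (elim eventually_mono, intro impI)
    fix x :: real assume "x \<notin> ?N" "0 < x"
    then have "continuous (at x within {0..}) (\<lambda>x. - \<kappa> x)" by auto
    moreover have "0 < \<kappa> x" using \<kappa>(1)[of x] \<open>0 < x\<close> by simp
    ultimately obtain d where d: "d > 0" "\<And>a. 0 \<le> a \<Longrightarrow> \<bar>a - x\<bar> < d \<Longrightarrow> \<bar>\<kappa> x - \<kappa> a\<bar> < \<kappa> x"
      unfolding continuous_within_eps_delta by (auto simp: dist_real_def)
    have "\<kappa> a \<le> 2 * \<kappa> x" if "x - d < a" "0 \<le> a" "a \<le> x" for a using d(2)[of a] that by auto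
    then show "\<exists>d>0. \<forall>a. x - d < a \<longrightarrow> 0 \<le> a \<longrightarrow> a \<le> x \<longrightarrow> \<kappa> a \<le> 2 * \<kappa> x" using d(1) by blast
  qed
qed

lemma eventually_knot_interval:
  assumes x: "0 < x" and d: "0 < d"
  shows "\<forall>\<^sub>F n in sequentially. \<exists>i a b. knot_interval n i a b \<and> a \<le> x \<and> x < b \<and> x - d < a \<and> b < x + d"
proof -
  define \<eta> where "\<eta> = min (d / 2) x"
  have \<eta>: "0 < \<eta>" "\<eta> < d" "\<eta> \<le> x" using x d by (auto simp: \<eta>_def)
  \<comment> \<open>Once the mass L/n of a knot interval is below both increments of
    \<open>F\<close>, the knots on either side of x lie within \<eta> of x.\<close>
  define e where "e = min (F (x + \<eta>) - F x) (F x - F (x - \<eta>))"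
  have e: "e > 0" using F_strict_mono[of x "x + \<eta>"] F_strict_mono[of "x - \<eta>" x] x \<eta> by (simp add: e_def)
  have "\<forall>\<^sub>F n in sequentially. L / e < real n"
    by (intro eventually_gt_at_top[THEN filterlim_real_sequentially[unfolded filterlim_iff, rule_format]])
  then show ?thesis
  proof eventually_elim
    case (elim n)
    then have n: "real n > 0" using L_pos e by (metis divide_pos_pos less_trans)
    have Ln: "L / real n < e" using elim n e by (simp add: field_simps)
    define i where "i = nat \<lfloor>real n * F x / L\<rfloor>"
    have "0 \<le> real n * F x / L" using F_nonneg L_pos n by simp
    then have i: "real i \<le> real n * F x / L" "real n * F x / L < real i + 1" unfolding i_def by linarith+
    have i1: "real i * L / real n \<le> F x" "F x < (real i + 1) * L / real n"
      using i n L_pos by (auto simp: field_simps)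
    have eq: "(real i + 1) * L / real n = real i * L / real n + L / real n"
      by (simp add: distrib_right add_divide_distrib)
    obtain a where a: "0 \<le> a" "a \<le> x" "F a = real i * L / real n"
      using F_IVT[of "real i * L / real n" x] i1 x L_pos by auto
    have b': "(real i + 1) * L / real n < F (x + \<eta>)" using eq i1 Ln by (simp add: e_def)
    then obtain b where b: "0 \<le> b" "b \<le> x + \<eta>" "F b = (real i + 1) * L / real n"
      using F_IVT[of "(real i + 1) * L / real n" "x + \<eta>"] x \<eta> L_pos by auto
    have "F (x - \<eta>) < F a" using a eq i1 Ln by (simp add: e_def)
    then have "x - \<eta> < a" using F_mono[of a "x - \<eta>"] a by (meson not_le)
    moreover have "x < b" using F_mono[of b x] b i1 by (cases "x < b") auto
    \<comment> \<open>The mass to the left of b is below that of a finite point, hence below the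
      total, so the interval found is not the last one.\<close>
    moreover have "(real i + 1) * L / real n < L" using b' F_le_L[of "x + \<eta>"] by simp
    then have "i + 1 < n" using L_pos n by (simp add: divide_less_eq)
    ultimately have "knot_interval n i a b \<and> a \<le> x \<and> x < b \<and> x - d < a \<and> b < x + d"
      using a b \<eta> unfolding knot_interval_def by auto
    then show ?case by blast
  qed
qed

lemma AE_eventually_good: "AE x in LD. 0 < x \<and> (\<forall>\<^sub>F n in sequentially. \<exists>i a b. good n i a b x)"
proof -
  have "AE x in lebesgue. x \<noteq> (0::real)"
    by (rule AE_not_in[of "{0}", simplified]) (simp add: negligible_iff_null_sets[symmetric])
  then have "AE x in lebesgue. x \<in> {0..} \<longrightarrow> 0 < x \<and> (\<forall>\<^sub>F n in sequentially. \<exists>i a b. good n i a b x)"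
    using AE_dense_point AE_continuous_\<kappa>
  proof (eventually_elim, intro impI)
    fix x :: real
    assume elim: "x \<noteq> 0"
      "0 < x \<longrightarrow> (\<exists>d>0. \<forall>a b. x - d < a \<longrightarrow> a \<le> x \<longrightarrow> x < b \<longrightarrow> b < x + d \<longrightarrow>
        (1 - bump_const r) * (b - a) \<le> measure lebesgue (E x \<inter> {a..<b}))"
      "0 < x \<longrightarrow> (\<exists>d>0. \<forall>a. x - d < a \<longrightarrow> 0 \<le> a \<longrightarrow> a \<le> x \<longrightarrow> \<kappa> a \<le> 2 * \<kappa> x)"
      "x \<in> {0..}"
    then have x: "0 < x" by simp
    obtain d1 where d1: "d1 > 0" "\<And>a b. x - d1 < a \<Longrightarrow> a \<le> x \<Longrightarrow> x < b \<Longrightarrow> b < x + d1 \<Longrightarrow>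
      (1 - bump_const r) * (b - a) \<le> measure lebesgue (E x \<inter> {a..<b})" using elim x by auto
    obtain d2 where d2: "d2 > 0" "\<And>a. x - d2 < a \<Longrightarrow> 0 \<le> a \<Longrightarrow> a \<le> x \<Longrightarrow> \<kappa> a \<le> 2 * \<kappa> x" using elim x by auto
    have "\<forall>\<^sub>F n in sequentially. \<exists>i a b. knot_interval n i a b \<and> a \<le> x \<and> x < b \<and> x - min d1 d2 < a \<and> b < x + min d1 d2"
      using d1 d2 x by (intro eventually_knot_interval) auto
    then have "\<forall>\<^sub>F n in sequentially. \<exists>i a b. good n i a b x"
    proof eventually_elim
      case (elim n)
      then obtain i a b where *: "knot_interval n i a b" "a \<le> x" "x < b" "x - min d1 d2 < a" "b < x + min d1 d2"
        by blast
      then have "good n i a b x" using d1(2)[of a b] d2(2)[of a] by (auto simp: good_def knot_interval_def)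
      then show ?case by blast
    qed
    then show "0 < x \<and> (\<forall>\<^sub>F n in sequentially. \<exists>i a b. good n i a b x)" using x by blast
  qed
  then show ?thesis by (subst AE_restrict_space_iff) auto
qed

end

section \<open>Lower bounds for the worst-case error\<close>

context sampling
begin

definition v where "v x = \<rho> x / \<psi> x / \<kappa> x"

lemma v_pos: "0 \<le> x \<Longrightarrow> 0 < v x"
  using \<psi> \<rho> \<kappa> by (simp add: v_def)

lemma knot_interval_disjoint:
  assumes "knot_interval n i a b" "knot_interval n j a' b'" "a \<le> x" "x < b" "a' \<le> x" "x < b'"
  shows "i = j"
proof -
  have lt: "i < j + 1"
    if "knot_interval n i a b" "knot_interval n j a' b'" "a \<le> x" "x < b'" "a' \<le> x" for i j a b a' b'
  proof -
    have "F a \<le> F x" "F x < F b'" using that F_mono[of a x] F_strict_mono[of x b'] by (auto simp: knot_interval_def)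
    then have "real i * L / real n < (real j + 1) * L / real n" using that by (simp add: knot_interval_def)
    then have "real i < real j + 1" using L_pos that by (auto simp: divide_less_cancel knot_interval_def)
    then show ?thesis by linarith
  qed
  from lt[OF assms(1,2)] lt[OF assms(2,1)] show ?thesis using assms by force
qed

lemma knot_interval_unique:
  assumes "knot_interval n i a b" "knot_interval n i a' b'" shows "a = a'" "b = b'"
  using assms F_inj[of a a'] F_inj[of b b'] by (auto simp: knot_interval_def)

lemma knot_outside:
  assumes "knot_interval n i a b" "is_knot \<kappa> \<alpha> n t" shows "t \<le> a \<or> b \<le> t"
proof (rule ccontr)
  assume "\<not> ?thesis"
  then have "F a < F t" "F t < F b" using assms F_strict_mono[of a t] F_strict_mono[of t b] by (auto simp: knot_interval_def)
  moreover obtain j where "F t = real j * L / real n" using assms by (auto simp: is_knot_iff)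
  ultimately have "real i * L / real n < real j * L / real n" "real j * L / real n < (real i + 1) * L / real n"
    using assms by (auto simp: knot_interval_def)
  then have "real i < real j" "real j < real i + 1"
    using L_pos assms by (auto simp: divide_less_cancel knot_interval_def)
  then have "i < j" "j < i + 1" by linarith+
  then show False by simp
qed

section \<open>The ratio achieved on a single good interval\<close>

lemma good_imp:
  assumes "good n i a b x"
  shows "knot_interval n i a b" "0 \<le> a" "a < b" "0 \<le> x" "0 < n" "\<kappa> a \<le> 2 * \<kappa> x"
  using assms by (auto simp: good_def knot_interval_def)

text \<open>Equidistribution gives L/n \<le> \<open>K a * (b - a)\<close>. Raising this to the power
  \<alpha> turns \<open>K a\<close> into \<open>\<kappa> a\<close>, which is at most
  \<open>2 * \<kappa> x\<close>.\<close>

lemma good_length: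
  assumes "good n i a b x"
  shows "(L / real n) powr \<alpha> / (2 * \<kappa> x) \<le> (b - a) powr \<alpha>"
proof -
  note g = good_imp[OF assms]
  have "L / real n = F b - F a" using g by (simp add: knot_interval_def field_simps)
  also have "\<dots> \<le> K a * (b - a)" using g by (intro F_diff) auto
  finally have "(L / real n) powr \<alpha> \<le> (K a * (b - a)) powr \<alpha>"
    using alpha_pos L_pos by (intro powr_mono2) auto
  also have "\<dots> = \<kappa> a * (b - a) powr \<alpha>"
    using \<kappa>(1)[of a] g alpha_pos by (simp add: powr_mult K_def powr_powr)
  also have "\<dots> \<le> 2 * \<kappa> x * (b - a) powr \<alpha>" using g by (intro mult_right_mono) auto
  finally show ?thesis using \<kappa>(1)[of x] g by (simp add: field_simps)
qed

lemma inv_exp_q: "0 \<le> inv_exp q" "inv_exp q \<le> 1"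
  using exponent_finite[OF q] by (cases "q = \<infinity>"; simp add: inv_exp_def)+

text \<open>The right-hand side is the ratio of the bounds for the two norms of one bump, before the
  factor 2 for \<psi>. The powers of the length combine to \<alpha>. Of the 4, one factor 2 comes
  from \<rho> and one from \<kappa>; replacing \<open>bump_const r powr inv_exp q\<close> by
  \<open>bump_const r\<close> makes the constant independent of q.\<close>

lemma good_bound:
  assumes "good n i a b x"
  shows "(bump_const r)\<^sup>2 / 4 * (L / real n) powr \<alpha> * v x \<le>
    bump_const r * (b - a) ^ r * (\<rho> x / 2) * (bump_const r * (b - a)) powr inv_exp q / (\<psi> x * (b - a) powr inv_exp p)"
proof -
  note g = good_imp[OF assms]
  define c h where "c = bump_const r" and "h = b - a"
  have c: "0 < c" "c \<le> 1" using bump_const(1)[of r] bump_const_less_half[OF r] by (auto simp: c_def)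
  have h: "0 < h" using g by (simp add: h_def)
  have pos: "0 < \<rho> x" "0 < \<psi> x" "0 < \<kappa> x" using g \<rho> \<psi> \<kappa> by auto
  have c2: "c\<^sup>2 \<le> c * c powr inv_exp q"
  proof -
    have "c powr 1 \<le> c powr inv_exp q" using c inv_exp_q by (intro powr_mono') auto
    then show ?thesis using c by (simp add: power2_eq_square)
  qed
  have "h powr \<alpha> = h ^ r * h powr inv_exp q / h powr inv_exp p"
    using h by (simp add: alpha_def powr_add powr_diff powr_realpow)
  then have eq: "c * h ^ r * (\<rho> x / 2) * (c * h) powr inv_exp q / (\<psi> x * h powr inv_exp p)
      = (c * c powr inv_exp q) * (\<rho> x / \<psi> x / 2) * h powr \<alpha>"
    using c h by (simp add: powr_mult mult_ac)
  have "c\<^sup>2 / 4 * (L / real n) powr \<alpha> * v x = c\<^sup>2 * (\<rho> x / \<psi> x / 2) * ((L / real n) powr \<alpha> / (2 * \<kappa> x))"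
    by (simp add: v_def)
  also have "\<dots> \<le> (c * c powr inv_exp q) * (\<rho> x / \<psi> x / 2) * h powr \<alpha>"
    using c2 good_length[OF assms] pos c by (intro mult_mono) (auto simp: h_def)
  finally show ?thesis unfolding eq[symmetric] by (simp add: c_def h_def)
qed

text \<open>Both level sets fill more than half of the interval, so they meet and therefore
  coincide. Each of \<rho>, \<psi> and \<kappa> then contributes a factor 2.\<close>

lemma good_compare:
  assumes "good n i a b x" "good n i a b y"
  shows "v x \<le> 8 * v y"
proof -
  note g = good_imp[OF assms(1)] and g' = good_imp[OF assms(2)]
  have "E x \<inter> E y \<noteq> {}"
  proof
    assume "E x \<inter> E y = {}"
    then have disj: "(E x \<inter> {a..<b}) \<inter> (E y \<inter> {a..<b}) = {}" by auto
    have m: "E z \<inter> {a..<b} \<in> lmeasurable" for z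
    proof (rule fmeasurableI2[of "{a..b}"])
      show "E z \<inter> {a..<b} \<in> sets lebesgue" by (intro sets.Int E_measurable) simp
    qed auto
    have "measure lebesgue (E x \<inter> {a..<b}) + measure lebesgue (E y \<inter> {a..<b})
        = measure lebesgue ((E x \<inter> {a..<b}) \<union> (E y \<inter> {a..<b}))"
      using disj m by (simp add: measure_Un3)
    also have "\<dots> \<le> measure lebesgue {a..b}"
      using m by (intro measure_mono_fmeasurable) auto
    also have "measure lebesgue {a..b} = b - a" using g(3) by simp
    finally have "2 * ((1 - bump_const r) * (b - a)) \<le> b - a"
      using assms unfolding good_def by linarith
    then have "2 * (1 - bump_const r) \<le> 1" using g by (simp add: mult.assoc[symmetric])
    then show False using bump_const_less_half[OF r] by simp
  qed
  then obtain z where z: "z \<in> E x" "z \<in> E y" by auto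
  then have "x \<in> E y" using g by (auto simp: E_def)
  note b = E_bounds[OF this g'(4)]
  have pos: "0 < \<rho> y" "0 < \<psi> x" "0 < \<kappa> x" "0 < \<psi> y" "0 < \<kappa> y" using g g' \<rho> \<psi> \<kappa> by auto
  have "\<kappa> y \<le> \<kappa> a" using assms(2) g' by (intro \<kappa>(2)) (auto simp: good_def)
  then have "\<kappa> y \<le> 2 * \<kappa> x" using g by simp
  then have "\<rho> x / (\<psi> x * \<kappa> x) \<le> (2 * \<rho> y) / ((\<psi> y / 2) * (\<kappa> y / 2))"
    using b pos by (intro frac_le mult_mono) auto
  then show ?thesis by (simp add: v_def)
qed

text \<open>Because each bump returns to zero with all its lower-order integrals at the right end of
  its interval, the \<open>r\<close>-fold integrals do not leak into other intervals. On each
  interval only one term of the sum is active, both for g and for its integral, and the weights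
  change by at most a factor 2 from their values at \<open>y i\<close>.\<close>

lemma bump_family:
  assumes G: "finite G" "\<And>i. i \<in> G \<Longrightarrow> good n i (a i) (b i) (y i)" and w: "\<And>i. i \<in> G \<Longrightarrow> 0 \<le> w i"
  obtains g S T where "bdd_meas g" "\<And>t k. is_knot \<kappa> \<alpha> n t \<Longrightarrow> 1 \<le> k \<Longrightarrow> k \<le> r \<Longrightarrow> iint k g t = 0"
    "disjoint_family_on T G" "\<And>i. i \<in> G \<Longrightarrow> T i \<in> sets lebesgue" "\<And>i. i \<in> G \<Longrightarrow> T i \<subseteq> {0..}"
    "\<And>i. i \<in> G \<Longrightarrow> ennreal (bump_const r * (b i - a i)) \<le> emeasure lebesgue (T i)"
    "\<And>i x. i \<in> G \<Longrightarrow> x \<in> T i \<Longrightarrow> w i * (bump_const r * (b i - a i) ^ r * (\<rho> (y i) / 2)) \<le> \<bar>iint r g x * \<rho> x\<bar>"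
    "\<And>i. i \<in> G \<Longrightarrow> S i \<in> sets lebesgue" "\<And>i. i \<in> G \<Longrightarrow> S i \<subseteq> {0..}"
    "\<And>i. i \<in> G \<Longrightarrow> emeasure lebesgue (S i) \<le> ennreal (b i - a i)"
    "\<And>i x. i \<in> G \<Longrightarrow> x \<in> S i \<Longrightarrow> \<bar>g x * \<psi> x\<bar> \<le> w i * (2 * \<psi> (y i))"
    "\<And>x. x \<notin> (\<Union>i\<in>G. S i) \<Longrightarrow> g x = 0"
proof -
  note g = good_imp[OF G(2)]
  define S where "S i = E (y i) \<inter> {a i..<b i}" for i
  have Sm: "S i \<in> sets lebesgue" for i using E_measurable by (auto simp: S_def)
  have "\<forall>i\<in>G. \<exists>g T. bdd_meas g \<and> (\<forall>x. \<bar>g x\<bar> \<le> 1) \<and> (\<forall>x. x \<notin> S i \<longrightarrow> g x = 0) \<and>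
    (\<forall>k x. 1 \<le> k \<longrightarrow> k \<le> r \<longrightarrow> x \<le> a i \<or> b i \<le> x \<longrightarrow> iint k g x = 0) \<and>
    T \<in> sets lebesgue \<and> T \<subseteq> S i \<and> measure lebesgue T \<ge> bump_const r * (b i - a i) \<and>
    (\<forall>x\<in>T. \<bar>iint r g x\<bar> \<ge> bump_const r * (b i - a i) ^ r)"
  proof
    fix i assume i: "i \<in> G"
    obtain g T where *: "bdd_meas g" "\<And>x. \<bar>g x\<bar> \<le> 1" "\<And>x. x \<notin> S i \<Longrightarrow> g x = 0"
      "\<And>k x. 1 \<le> k \<Longrightarrow> k \<le> r \<Longrightarrow> x \<le> a i \<or> b i \<le> x \<Longrightarrow> iint k g x = 0"
      "T \<in> sets lebesgue" "T \<subseteq> S i" "measure lebesgue T \<ge> bump_const r * (b i - a i)"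
      "\<And>x. x \<in> T \<Longrightarrow> \<bar>iint r g x\<bar> \<ge> bump_const r * (b i - a i) ^ r"
      using exists_bump[OF r g(2,3)[OF i], of "S i"] Sm[of i] G(2)[OF i] by (auto simp: good_def S_def)
    show "\<exists>g T. bdd_meas g \<and> (\<forall>x. \<bar>g x\<bar> \<le> 1) \<and> (\<forall>x. x \<notin> S i \<longrightarrow> g x = 0) \<and>
      (\<forall>k x. 1 \<le> k \<longrightarrow> k \<le> r \<longrightarrow> x \<le> a i \<or> b i \<le> x \<longrightarrow> iint k g x = 0) \<and>
      T \<in> sets lebesgue \<and> T \<subseteq> S i \<and> measure lebesgue T \<ge> bump_const r * (b i - a i) \<and>
      (\<forall>x\<in>T. \<bar>iint r g x\<bar> \<ge> bump_const r * (b i - a i) ^ r)"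
      by (rule exI[of _ g], rule exI[of _ T]) (use * in simp)
  qed
  from bchoice[OF this] obtain \<gamma> where "\<forall>i\<in>G. \<exists>T. bdd_meas (\<gamma> i) \<and> (\<forall>x. \<bar>\<gamma> i x\<bar> \<le> 1) \<and> (\<forall>x. x \<notin> S i \<longrightarrow> \<gamma> i x = 0) \<and>
    (\<forall>k x. 1 \<le> k \<longrightarrow> k \<le> r \<longrightarrow> x \<le> a i \<or> b i \<le> x \<longrightarrow> iint k (\<gamma> i) x = 0) \<and>
    T \<in> sets lebesgue \<and> T \<subseteq> S i \<and> measure lebesgue T \<ge> bump_const r * (b i - a i) \<and>
    (\<forall>x\<in>T. \<bar>iint r (\<gamma> i) x\<bar> \<ge> bump_const r * (b i - a i) ^ r)" ..
  from bchoice[OF this] obtain T where "\<forall>i\<in>G. bdd_meas (\<gamma> i) \<and> (\<forall>x. \<bar>\<gamma> i x\<bar> \<le> 1) \<and> (\<forall>x. x \<notin> S i \<longrightarrow> \<gamma> i x = 0) \<and>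
    (\<forall>k x. 1 \<le> k \<longrightarrow> k \<le> r \<longrightarrow> x \<le> a i \<or> b i \<le> x \<longrightarrow> iint k (\<gamma> i) x = 0) \<and>
    T i \<in> sets lebesgue \<and> T i \<subseteq> S i \<and> measure lebesgue (T i) \<ge> bump_const r * (b i - a i) \<and>
    (\<forall>x\<in>T i. \<bar>iint r (\<gamma> i) x\<bar> \<ge> bump_const r * (b i - a i) ^ r)"
    ..
  then have \<gamma>: "\<And>i. i \<in> G \<Longrightarrow> bdd_meas (\<gamma> i)" "\<And>i x. i \<in> G \<Longrightarrow> \<bar>\<gamma> i x\<bar> \<le> 1"
      "\<And>i x. i \<in> G \<Longrightarrow> x \<notin> S i \<Longrightarrow> \<gamma> i x = 0"
      "\<And>i k x. i \<in> G \<Longrightarrow> 1 \<le> k \<Longrightarrow> k \<le> r \<Longrightarrow> x \<le> a i \<or> b i \<le> x \<Longrightarrow> iint k (\<gamma> i) x = 0"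
    and T: "\<And>i. i \<in> G \<Longrightarrow> T i \<in> sets lebesgue" "\<And>i. i \<in> G \<Longrightarrow> T i \<subseteq> S i"
      "\<And>i. i \<in> G \<Longrightarrow> measure lebesgue (T i) \<ge> bump_const r * (b i - a i)"
      "\<And>i x. i \<in> G \<Longrightarrow> x \<in> T i \<Longrightarrow> \<bar>iint r (\<gamma> i) x\<bar> \<ge> bump_const r * (b i - a i) ^ r"
    by auto
  have S_disj: "i = j" if "i \<in> G" "j \<in> G" "x \<in> S i" "a j \<le> x" "x < b j" for i j x
    using that knot_interval_disjoint[OF g(1)[OF that(1)] g(1)[OF that(2)], of x] by (auto simp: S_def)
  have S_disj': "i = j" if "i \<in> G" "j \<in> G" "x \<in> S i" "x \<in> S j" for i j x
    using S_disj[of i j x] that by (auto simp: S_def)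
  define f where "f x = (\<Sum>i\<in>G. w i * \<gamma> i x)" for x
  have I: "iint k f x = (\<Sum>i\<in>G. w i * iint k (\<gamma> i) x)" for k x
    unfolding f_def by (rule iint_sum[OF \<gamma>(1) G(1)])
  have single: "(\<Sum>i\<in>G. w i * u i) = w j * u j" if "j \<in> G" "\<And>i. i \<in> G \<Longrightarrow> i \<noteq> j \<Longrightarrow> u i = 0" for u j
    using G(1) that by (subst sum.remove[of _ j]) (auto intro!: sum.neutral)
  show ?thesis
  proof (rule that)
    show "bdd_meas f" unfolding f_def by (rule bdd_meas_sum[OF \<gamma>(1)])
    show "iint k f t = 0" if "is_knot \<kappa> \<alpha> n t" "1 \<le> k" "k \<le> r" for t k
      unfolding I using knot_outside[OF g(1) that(1)] \<gamma>(4) that by (intro sum.neutral) auto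
    show "disjoint_family_on T G"
      using T(2) S_disj' by (auto simp: disjoint_family_on_def) blast
    fix i assume i: "i \<in> G"
    show "T i \<in> sets lebesgue" "S i \<in> sets lebesgue" using T(1)[OF i] Sm by auto
    show S0: "S i \<subseteq> {0..}" by (auto simp: S_def E_def)
    then show "T i \<subseteq> {0..}" using T(2)[OF i] by auto
    have "S i \<in> lmeasurable" by (rule fmeasurableI2[of "{a i..b i}", OF _ _ Sm]) (auto simp: S_def)
    then have "T i \<in> lmeasurable" by (rule fmeasurableI2[OF _ T(2,1)[OF i]])
    then show "ennreal (bump_const r * (b i - a i)) \<le> emeasure lebesgue (T i)"
      using T(3)[OF i] by (simp add: emeasure_eq_measure2 ennreal_leI)
    have "emeasure lebesgue (S i) \<le> emeasure lebesgue {a i..b i}" by (rule emeasure_mono) (auto simp: S_def)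
    then show "emeasure lebesgue (S i) \<le> ennreal (b i - a i)" using g(3)[OF i] by simp
    fix x
    show "w i * (bump_const r * (b i - a i) ^ r * (\<rho> (y i) / 2)) \<le> \<bar>iint r f x * \<rho> x\<bar>" if x: "x \<in> T i"
    proof -
      have xS: "x \<in> S i" using x T(2)[OF i] by auto
      have "iint r (\<gamma> j) x = 0" if j: "j \<in> G" "j \<noteq> i" for j
        using \<gamma>(4)[OF j(1), of r x] S_disj[OF i j(1) xS] j r by fastforce
      then have "iint r f x = w i * iint r (\<gamma> i) x" unfolding I by (intro single i)
      have "\<rho> (y i) / 2 \<le> \<rho> x" "0 \<le> \<rho> (y i)" using xS E_bounds[of x "y i"] g(4)[OF i] \<rho>(1)[of "y i"] by (auto simp: S_def)
      have "0 \<le> bump_const r * (b i - a i) ^ r" using bump_const(1)[of r] g(3)[OF i] by simp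
      then have "bump_const r * (b i - a i) ^ r * (\<rho> (y i) / 2) \<le> \<bar>iint r (\<gamma> i) x\<bar> * \<bar>\<rho> x\<bar>"
        using T(4)[OF i x] \<open>\<rho> (y i) / 2 \<le> \<rho> x\<close> \<open>0 \<le> \<rho> (y i)\<close> by (intro mult_mono) auto
      then have "w i * (bump_const r * (b i - a i) ^ r * (\<rho> (y i) / 2)) \<le> w i * (\<bar>iint r (\<gamma> i) x\<bar> * \<bar>\<rho> x\<bar>)"
        using w[OF i] by (rule mult_left_mono)
      also have "\<dots> = \<bar>iint r f x * \<rho> x\<bar>" using \<open>iint r f x = w i * iint r (\<gamma> i) x\<close> w[OF i] by (simp add: abs_mult)
      finally show ?thesis .
    qed
    show "\<bar>f x * \<psi> x\<bar> \<le> w i * (2 * \<psi> (y i))" if x: "x \<in> S i"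
    proof -
      have "f x = w i * \<gamma> i x" unfolding f_def using \<gamma>(3) S_disj'[OF _ i _ x] by (intro single i) metis
      moreover have "\<bar>\<psi> x\<bar> \<le> 2 * \<psi> (y i)" using x E_bounds[of x "y i"] g(4)[OF i] \<psi>(1)[of x] by (auto simp: S_def E_def)
      ultimately show ?thesis using \<gamma>(2)[OF i, of x] w[OF i] mult_mono[of "\<bar>\<gamma> i x\<bar>" 1 "\<bar>\<psi> x\<bar>" "2 * \<psi> (y i)"]
        by (simp add: abs_mult mult.assoc mult_left_mono)
    qed
  next
    show "f x = 0" if "x \<notin> (\<Union>i\<in>G. S i)" for x
      unfolding f_def using that \<gamma>(3) by (intro sum.neutral) auto
  qed
qed

section \<open>Error bounds from one bump and from many\<close>

definition admissible where
  "admissible n B \<longleftrightarrow> (\<forall>f g. in_F r p \<psi> f \<longrightarrow> in_F r p \<psi> g \<longrightarrow>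
          (\<forall>t. is_knot \<kappa> \<alpha> n t \<longrightarrow> (\<forall>j<r. (Dw ^^ j) f t = (Dw ^^ j) g t)) \<longrightarrow>
          (\<forall>x\<ge>0. B f x = B g x)) \<and> (\<forall>f. in_F r p \<psi> f \<longrightarrow> B f \<in> borel_measurable LD)"

lemma worst_err_ge:
  assumes "admissible n B" "bdd_meas g" "\<And>t k. is_knot \<kappa> \<alpha> n t \<Longrightarrow> 1 \<le> k \<Longrightarrow> k \<le> r \<Longrightarrow> iint k g t = 0"
    "0 < M" "Lnorm p (\<lambda>x. g x * \<psi> x) \<le> ennreal M" "0 < N" "ennreal N \<le> Lnorm q (\<lambda>x. iint r g x * \<rho> x)"
  shows "ennreal (N / (2 * M)) \<le> worst_err r p q \<psi> \<rho> B"
proof (rule worst_err_ge_of_fooling_function[OF r p q \<psi>(2,1) \<rho>(2) _ _ assms(2) _ _ assms(4-7),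
      where X="{t. is_knot \<kappa> \<alpha> n t}"])
  show "{t. is_knot \<kappa> \<alpha> n t} \<subseteq> {0..}" by (auto simp: is_knot_def)
  show "B f \<in> borel_measurable LD" if "in_F r p \<psi> f" for f
    using assms(1) that by (simp add: admissible_def)
  show "B f x = B f' x" if "in_F r p \<psi> f" "in_F r p \<psi> f'" "0 \<le> x"
    "\<And>t j. t \<in> {t. is_knot \<kappa> \<alpha> n t} \<Longrightarrow> j < r \<Longrightarrow> (Dw ^^ j) f t = (Dw ^^ j) f' t" for f f' x
  proof -
    have "\<forall>t. is_knot \<kappa> \<alpha> n t \<longrightarrow> (\<forall>j<r. (Dw ^^ j) f t = (Dw ^^ j) f' t)" using that(4) by simp
    then show ?thesis using assms(1) that(1-3) unfolding admissible_def by blast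
  qed
  show "iint k g t = 0" if "t \<in> {t. is_knot \<kappa> \<alpha> n t}" "1 \<le> k" "k \<le> r" for t k
    using assms(3) that by simp
qed

text \<open>16 is the 4 of \<open>good_bound\<close>, times 2 for the variation of \<psi> in M,
  times 2 for the pair f, -f.\<close>

lemma worst_err_ge_single:
  assumes "admissible n B" "good n i a b x"
  shows "ennreal ((bump_const r)\<^sup>2 / 16 * (L / real n) powr \<alpha> * v x) \<le> worst_err r p q \<psi> \<rho> B"
proof -
  let ?c = "bump_const r" and ?h = "b - a"
  note g = good_imp[OF assms(2)]
  have c: "0 < ?c" by (rule bump_const)
  have pos: "0 < \<rho> x" "0 < \<psi> x" using g \<rho> \<psi> by auto
  show ?thesis
  proof (rule bump_family[of "{i}" n "\<lambda>_. a" "\<lambda>_. b" "\<lambda>_. x" "\<lambda>_. 1"])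
    fix f S T
    assume f: "bdd_meas f" "\<And>t k. is_knot \<kappa> \<alpha> n t \<Longrightarrow> 1 \<le> k \<Longrightarrow> k \<le> r \<Longrightarrow> iint k f t = 0"
    and T: "\<And>j. j \<in> {i} \<Longrightarrow> T j \<in> sets lebesgue" "\<And>j. j \<in> {i} \<Longrightarrow> T j \<subseteq> {0..}"
      "\<And>j. j \<in> {i} \<Longrightarrow> ennreal (?c * ?h) \<le> emeasure lebesgue (T j)"
      "\<And>j z. j \<in> {i} \<Longrightarrow> z \<in> T j \<Longrightarrow> 1 * (?c * ?h ^ r * (\<rho> x / 2)) \<le> \<bar>iint r f z * \<rho> z\<bar>"
    and S: "\<And>j. j \<in> {i} \<Longrightarrow> S j \<in> sets lebesgue" "\<And>j. j \<in> {i} \<Longrightarrow> S j \<subseteq> {0..}"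
      "\<And>j. j \<in> {i} \<Longrightarrow> emeasure lebesgue (S j) \<le> ennreal ?h"
      "\<And>j z. j \<in> {i} \<Longrightarrow> z \<in> S j \<Longrightarrow> \<bar>f z * \<psi> z\<bar> \<le> 1 * (2 * \<psi> x)"
      "\<And>z. z \<notin> (\<Union>j\<in>{i}. S j) \<Longrightarrow> f z = 0"
  define N where "N = ?c * ?h ^ r * (\<rho> x / 2) * (?c * ?h) powr inv_exp q"
  define M where "M = 2 * \<psi> x * ?h powr inv_exp p"
  have N: "0 < N" "ennreal N \<le> Lnorm q (\<lambda>x. iint r f x * \<rho> x)"
  proof -
    show "0 < N" using c g pos by (simp add: N_def)
    show "ennreal N \<le> Lnorm q (\<lambda>x. iint r f x * \<rho> x)"
      unfolding N_def using c g pos T(1-3)[OF singletonI] T(4)[OF singletonI]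
      by (intro Lnorm_lower[OF q, of "T i"]) (simp_all only: mult_1, simp_all)
  qed
  have M: "0 < M" "Lnorm p (\<lambda>x. f x * \<psi> x) \<le> ennreal M"
  proof -
    show "0 < M" using g pos by (simp add: M_def)
    show "Lnorm p (\<lambda>x. f x * \<psi> x) \<le> ennreal M"
      unfolding M_def using g pos S(1-3)[OF singletonI] S(4)[OF singletonI] S(5)
      by (intro Lnorm_upper[OF p, of "S i"]) auto
  qed
  have "?c\<^sup>2 / 16 * (L / real n) powr \<alpha> * v x \<le> N / (2 * M)"
    using good_bound[OF assms(2)] by (simp add: N_def M_def)
  then have "ennreal (?c\<^sup>2 / 16 * (L / real n) powr \<alpha> * v x) \<le> ennreal (N / (2 * M))" by (rule ennreal_leI)
  also have "\<dots> \<le> worst_err r p q \<psi> \<rho> B" by (rule worst_err_ge[OF assms(1) f M N])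
  finally show ?thesis .
  qed (use assms(2) in simp_all)
qed

text \<open>With suitable weights both norms become powers of one sum Z: the numerator has exponent
  1/q and the denominator 1/p, so the ratio carries Z to the power \<sigma>.\<close>

lemma worst_err_ge_sum:
  assumes B: "admissible n B" and pq: "\<not> p \<le> q" and G: "finite G" "G \<noteq> {}"
    "\<And>i. i \<in> G \<Longrightarrow> good n i (a i) (b i) (y i)"
    and \<sigma>: "\<sigma> = inv_exp q - inv_exp p" "0 < \<sigma>"
  shows "ennreal ((bump_const r)\<^sup>2 / 16 * (L / real n) powr \<alpha> * (\<Sum>i\<in>G. v (y i) powr (1 / \<sigma>)) powr \<sigma>)
    \<le> worst_err r p q \<psi> \<rho> B"
proof -
  let ?c = "bump_const r" and ?q = "enn2real q" and ?Q = "inv_exp q" and ?P = "inv_exp p"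
  note g = good_imp[OF G(3)]
  have c: "0 < ?c" by (rule bump_const)
  have qfin: "q \<noteq> \<infinity>" using pq by auto
  note qf = exponent_finite[OF q qfin]
  define h where "h i = b i - a i" for i
  have h: "0 < h i" if "i \<in> G" for i using g(3)[OF that] by (simp add: h_def)
  have pos: "0 < \<rho> (y i)" "0 < \<psi> (y i)" "0 < v (y i)" if "i \<in> G" for i
    using g(4)[OF that] \<rho> \<psi> v_pos by auto
  \<comment> \<open>This is the equality case of Hoelder's inequality. The p-th power of
    \<open>w i * \<psi> (y i)\<close> times the length is
    \<open>v (y i) powr (1 / \<sigma>)\<close>, and since
    \<open>?Q / \<sigma> = ?P / \<sigma> + 1\<close>, the numerator contributes at least
    \<open>D powr ?q\<close> times the same quantity.\<close>
  define w where "w i = v (y i) powr (?P / \<sigma>) / (\<psi> (y i) * h i powr ?P)" for i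
  have w: "0 < w i" if "i \<in> G" for i using pos[OF that] h[OF that] by (simp add: w_def)
  define Z where "Z = (\<Sum>i\<in>G. v (y i) powr (1 / \<sigma>))"
  have Z: "0 < Z" unfolding Z_def
  proof (rule sum_pos[OF G(1,2)])
    show "0 < v (y i) powr (1 / \<sigma>)" if "i \<in> G" for i using pos(3)[OF that] by simp
  qed
  define D where "D = ?c\<^sup>2 / 4 * (L / real n) powr \<alpha>"
  obtain i0 where "i0 \<in> G" using G by auto
  then have D: "0 < D" using c L_pos g(5)[of i0] by (simp add: D_def)
  show ?thesis
  proof (rule bump_family[OF G(1,3) less_imp_le[OF w]])
    fix f S T
    assume f: "bdd_meas f" "\<And>t k. is_knot \<kappa> \<alpha> n t \<Longrightarrow> 1 \<le> k \<Longrightarrow> k \<le> r \<Longrightarrow> iint k f t = 0"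
    and T: "disjoint_family_on T G" "\<And>i. i \<in> G \<Longrightarrow> T i \<in> sets lebesgue" "\<And>i. i \<in> G \<Longrightarrow> T i \<subseteq> {0..}"
      "\<And>i. i \<in> G \<Longrightarrow> ennreal (?c * (b i - a i)) \<le> emeasure lebesgue (T i)"
      "\<And>i x. i \<in> G \<Longrightarrow> x \<in> T i \<Longrightarrow> w i * (?c * (b i - a i) ^ r * (\<rho> (y i) / 2)) \<le> \<bar>iint r f x * \<rho> x\<bar>"
    and S: "\<And>i. i \<in> G \<Longrightarrow> S i \<in> sets lebesgue" "\<And>i. i \<in> G \<Longrightarrow> S i \<subseteq> {0..}"
      "\<And>i. i \<in> G \<Longrightarrow> emeasure lebesgue (S i) \<le> ennreal (b i - a i)"
      "\<And>i x. i \<in> G \<Longrightarrow> x \<in> S i \<Longrightarrow> \<bar>f x * \<psi> x\<bar> \<le> w i * (2 * \<psi> (y i))"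
      "\<And>x. x \<notin> (\<Union>i\<in>G. S i) \<Longrightarrow> f x = 0"
    define N where "N = D * Z powr ?Q"
    define M where "M = 2 * Z powr ?P"
    have N: "0 < N" "ennreal N \<le> Lnorm q (\<lambda>x. iint r f x * \<rho> x)"
    proof -
      show "0 < N" using D Z by (simp add: N_def)
      define C where "C i = w i * (?c * h i ^ r * (\<rho> (y i) / 2))" for i
      have C: "0 < C i" if "i \<in> G" for i using pos[OF that] h[OF that] w[OF that] c by (simp add: C_def)
      have term_le: "(D * v (y i) powr (?Q / \<sigma>)) powr ?q \<le> C i powr ?q * (?c * h i)" if i: "i \<in> G" for i
      proof -
        have "?Q / \<sigma> = ?P / \<sigma> + 1" using \<sigma> by (simp add: field_simps)
        then have "v (y i) powr (?Q / \<sigma>) = v (y i) powr (?P / \<sigma>) * v (y i)"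
          using pos[OF i] by (simp add: powr_add)
        then have "D * v (y i) powr (?Q / \<sigma>) = v (y i) powr (?P / \<sigma>) * (D * v (y i))" by simp
        also have "\<dots> \<le> v (y i) powr (?P / \<sigma>) *
            (?c * h i ^ r * (\<rho> (y i) / 2) * (?c * h i) powr ?Q / (\<psi> (y i) * h i powr ?P))"
          using good_bound[OF G(3)[OF i]] by (intro mult_left_mono) (simp_all add: D_def h_def)
        also have "\<dots> = C i * (?c * h i) powr ?Q" by (simp add: C_def w_def)
        finally have "(D * v (y i) powr (?Q / \<sigma>)) powr ?q \<le> (C i * (?c * h i) powr ?Q) powr ?q"
          using D qf by (intro powr_mono2) auto
        also have "\<dots> = C i powr ?q * (?c * h i)"
          using C[OF i] c h[OF i] qf by (simp add: powr_mult powr_powr)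
        finally show ?thesis .
      qed
      have "D powr ?q * Z = (\<Sum>i\<in>G. (D * v (y i) powr (?Q / \<sigma>)) powr ?q)"
        unfolding Z_def sum_distrib_left
      proof (rule sum.cong)
        show "D powr ?q * v (y i) powr (1 / \<sigma>) = (D * v (y i) powr (?Q / \<sigma>)) powr ?q" if "i \<in> G" for i
          using pos(3)[OF that] D qf by (simp add: powr_mult powr_powr)
      qed simp
      also have "\<dots> \<le> (\<Sum>i\<in>G. C i powr ?q * (?c * h i))" by (intro sum_mono term_le)
      finally have "(D powr ?q * Z) powr ?Q \<le> (\<Sum>i\<in>G. C i powr ?q * (?c * h i)) powr ?Q"
        using Z inv_exp_q by (intro powr_mono2) auto
      moreover have "(D powr ?q * Z) powr ?Q = N" using Z D qf by (simp add: N_def powr_mult powr_powr)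
      ultimately have "ennreal N \<le> ennreal ((\<Sum>i\<in>G. C i powr ?q * (?c * h i)) powr ?Q)" by (simp add: ennreal_leI)
      also have "\<dots> \<le> Lnorm q (\<lambda>x. iint r f x * \<rho> x)"
      proof (rule Lnorm_sum_lower[OF q qfin G(1) T(1-3)])
        show "ennreal (?c * h i) \<le> emeasure lebesgue (T i)" if "i \<in> G" for i using T(4)[OF that] by (simp add: h_def)
        show "C i \<le> \<bar>iint r f x * \<rho> x\<bar>" if "i \<in> G" "x \<in> T i" for i x using T(5)[OF that] by (simp add: h_def C_def)
        show "0 \<le> C i" "0 \<le> ?c * h i" if "i \<in> G" for i using C[OF that] c h[OF that] by auto
      qed
      finally show "ennreal N \<le> Lnorm q (\<lambda>x. iint r f x * \<rho> x)" .
    qed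
    have M: "0 < M" "Lnorm p (\<lambda>x. f x * \<psi> x) \<le> ennreal M"
    proof -
      show "0 < M" using Z by (simp add: M_def)
      have C: "w i * (2 * \<psi> (y i)) = 2 * v (y i) powr (?P / \<sigma>) / h i powr ?P" if "i \<in> G" for i
        using pos[OF that] by (simp add: w_def)
      show "Lnorm p (\<lambda>x. f x * \<psi> x) \<le> ennreal M"
      proof (cases "p = \<infinity>")
        case True
        then have P0: "?P = 0" by (simp add: inv_exp_def)
        \<comment> \<open>With \<open>?P = 0\<close> the weight \<open>w i\<close> is
          \<open>1 / \<psi> (y i)\<close>, so every bump obeys the same bound 2.\<close>
        have "\<bar>f x * \<psi> x\<bar> \<le> 2" for x
        proof (cases "\<exists>i\<in>G. x \<in> S i")
          case True
          then obtain i where i: "i \<in> G" "x \<in> S i" by auto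
          then show ?thesis using S(4)[OF i] C[OF i(1)] P0 pos[OF i(1)] h[OF i(1)] by simp
        qed (use S(5) in auto)
        then show ?thesis using Lnorm_infinity_le[of "\<lambda>x. f x * \<psi> x" 2] True P0 Z by (simp add: M_def)
      next
        case False
        let ?p = "enn2real p"
        note pf = exponent_finite[OF p False]
        have "Lnorm p (\<lambda>x. f x * \<psi> x) \<le> ennreal ((\<Sum>i\<in>G. (w i * (2 * \<psi> (y i))) powr ?p * h i) powr ?P)"
        proof (rule Lnorm_sum_upper[OF p False G(1) S(1,2)])
          show "emeasure lebesgue (S i) \<le> ennreal (h i)" if "i \<in> G" for i using S(3)[OF that] by (simp add: h_def)
          show "0 \<le> w i * (2 * \<psi> (y i))" "0 \<le> h i" if "i \<in> G" for i using pos[OF that] w[OF that] h[OF that] by auto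
          show "f x * \<psi> x = 0" if "x \<notin> (\<Union>i\<in>G. S i)" for x using S(5)[OF that] by simp
        qed (use S(4) in auto)
        also have "(\<Sum>i\<in>G. (w i * (2 * \<psi> (y i))) powr ?p * h i) = (\<Sum>i\<in>G. 2 powr ?p * v (y i) powr (1 / \<sigma>))"
        proof (rule sum.cong)
          fix i assume i: "i \<in> G"
          show "(w i * (2 * \<psi> (y i))) powr ?p * h i = 2 powr ?p * v (y i) powr (1 / \<sigma>)"
            unfolding C[OF i] using pos[OF i] h[OF i] pf by (simp add: powr_mult powr_divide powr_powr)
        qed simp
        also have "\<dots> = 2 powr ?p * Z" by (simp add: Z_def sum_distrib_left)
        also have "(2 powr ?p * Z) powr ?P = M" using Z pf by (simp add: M_def powr_mult powr_powr)
        finally show ?thesis .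
      qed
    qed
    have "?c\<^sup>2 / 16 * (L / real n) powr \<alpha> * Z powr \<sigma> = N / (2 * M)"
      using Z by (simp add: N_def M_def D_def \<sigma>(1) powr_diff)
    then show ?thesis using worst_err_ge[OF B f M N] by (simp add: Z_def)
  qed
qed

end

section \<open>Passage to the limit\<close>

lemma ennreal_mult_le_iff:
  assumes "0 < k" shows "ennreal k * z \<le> Y \<longleftrightarrow> z \<le> Y / ennreal k"
proof -
  have div: "Y / ennreal k = ennreal (1 / k) * Y"
    using assms by (simp add: divide_ennreal_def inverse_ennreal inverse_eq_divide mult.commute)
  have one: "ennreal (1 / k) * ennreal k = 1" "ennreal k * ennreal (1 / k) = 1"
    using assms by (simp_all add: ennreal_mult[symmetric])
  show ?thesis
  proof
    assume "ennreal k * z \<le> Y"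
    then have "ennreal (1 / k) * (ennreal k * z) \<le> ennreal (1 / k) * Y" by (intro mult_left_mono) auto
    then show "z \<le> Y / ennreal k" using one by (simp add: div mult.assoc[symmetric])
  next
    assume "z \<le> Y / ennreal k"
    then have "ennreal k * z \<le> ennreal k * (ennreal (1 / k) * Y)" unfolding div by (intro mult_left_mono) auto
    then show "ennreal k * z \<le> Y" using one by (simp add: mult.assoc[symmetric])
  qed
qed

text \<open>A strict bound below the target is pulled back through the inverse power, compared with
  the liminf of \<open>J'\<close>, and pushed forward again. This handles J infinite without a
  separate case.\<close>

lemma liminf_epowr_lower:
  assumes k: "0 < k" and \<sigma>: "0 < \<sigma>" and J: "J \<le> liminf J'"
    and W: "\<forall>\<^sub>F n in sequentially. ennreal k * epowr (J' n) \<sigma> \<le> W n"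
  shows "ennreal k * epowr J \<sigma> \<le> liminf W"
  unfolding le_Liminf_iff
proof (intro allI impI)
  fix y assume "y < ennreal k * epowr J \<sigma>"
  then have "y / ennreal k < epowr J \<sigma>" using ennreal_mult_le_iff[OF k] by (meson not_le)
  then have "epowr (y / ennreal k) (1 / \<sigma>) < J"
    using epowr_strict_mono[of "y / ennreal k" "epowr J \<sigma>" "1 / \<sigma>"] \<sigma> by (simp add: epowr_inverse)
  then have "epowr (y / ennreal k) (1 / \<sigma>) < liminf J'" using J by (rule less_le_trans)
  then have "\<forall>\<^sub>F n in sequentially. epowr (y / ennreal k) (1 / \<sigma>) < J' n" by (rule less_LiminfD)
  with W show "\<forall>\<^sub>F n in sequentially. y < W n"
  proof eventually_elim
    case (elim n)
    have "y / ennreal k < epowr (J' n) \<sigma>"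
      using epowr_strict_mono[OF elim(2), of \<sigma>] epowr_inverse[of "1 / \<sigma>" "y / ennreal k"] \<sigma> by simp
    then have "y < ennreal k * epowr (J' n) \<sigma>" using ennreal_mult_le_iff[OF k] by (meson not_le)
    then show ?case using elim(1) by (rule less_le_trans)
  qed
qed

context sampling
begin

text \<open>One bump at almost every x bounds \<open>v x\<close> by the same number, the normalised
  liminf; that number is then an essential upper bound, hence above the norm in \<open>Epq\<close>.
  The rate exponent equals \<alpha> here.\<close>

lemma liminf_worst_err_p_le_q:
  assumes pq: "p \<le> q" and B: "\<And>n. 1 \<le> n \<Longrightarrow> admissible n (B n)"
  shows "ennreal ((bump_const r)\<^sup>2 / 128) * epowr (ennreal L) \<alpha> * Epq p q \<alpha> (\<lambda>x. \<rho> x / \<psi> x) \<kappa>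
    \<le> liminf (\<lambda>n. worst_err r p q \<psi> \<rho> (B n) * ennreal (real n powr (real r - max 0 (inv_exp p - inv_exp q))))"
    (is "_ \<le> liminf ?W")
proof -
  have "inv_exp q \<le> inv_exp p"
  proof (cases "q = \<infinity>")
    case True
    then show ?thesis using exponent_finite[OF p] by (cases "p = \<infinity>") (simp_all add: inv_exp_def)
  next
    case False
    then have "p \<noteq> \<infinity>" using pq by (auto simp: top_unique)
    note f = exponent_finite[OF q False] exponent_finite[OF p this]
    have "enn2real p \<le> enn2real q" using pq False by (intro enn2real_mono) (auto simp: less_top)
    then show ?thesis using f by (simp add: frac_le)
  qed
  then have exp: "real r - max 0 (inv_exp p - inv_exp q) = \<alpha>" by (simp add: alpha_def)
  define k where "k = (bump_const r)\<^sup>2 / 128 * L powr \<alpha>"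
  have k: "0 < k" using bump_const(1)[of r] L_pos by (simp add: k_def)
  have "AE x in LD. ennreal \<bar>v x\<bar> \<le> liminf ?W / ennreal k"
    using AE_eventually_good
  proof eventually_elim
    case (elim x)
    then have vx: "0 < v x" by (intro v_pos) simp
    have "\<forall>\<^sub>F n in sequentially. ennreal k * ennreal (v x) \<le> ?W n"
      using conjunct2[OF elim] eventually_ge_at_top[of 1]
    proof eventually_elim
      case (elim n)
      then obtain i a b where "good n i a b x" by blast
      from worst_err_ge_single[OF B[OF elim(2)] this]
      have "ennreal ((bump_const r)\<^sup>2 / 16 * (L / real n) powr \<alpha> * v x) * ennreal (real n powr \<alpha>) \<le> ?W n"
        unfolding exp by (rule mult_right_mono) simp
      also have "ennreal ((bump_const r)\<^sup>2 / 16 * (L / real n) powr \<alpha> * v x) * ennreal (real n powr \<alpha>)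
          = ennreal ((bump_const r)\<^sup>2 / 16 * (L / real n) powr \<alpha> * v x * real n powr \<alpha>)"
        using vx by (intro ennreal_mult[symmetric]) auto
      \<comment> \<open>The spare factor 8 is given away so that k agrees with the constant of the
        case q < p.\<close>
      also have "(bump_const r)\<^sup>2 / 16 * (L / real n) powr \<alpha> * v x * real n powr \<alpha> = 8 * (k * v x)"
        using elim(2) L_pos by (simp add: k_def powr_divide)
      finally have le: "ennreal (8 * (k * v x)) \<le> ?W n" .
      have "ennreal k * ennreal (v x) = ennreal (k * v x)" using k vx by (simp only: ennreal_mult less_imp_le)
      also have "\<dots> \<le> ennreal (8 * (k * v x))" using mult_pos_pos[OF k vx] by (intro ennreal_leI) linarith
      finally show ?case using le by (rule order_trans)
    qed
    then have "ennreal k * ennreal (v x) \<le> liminf ?W" by (rule Liminf_bounded)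
    then show ?case using ennreal_mult_le_iff[OF k] vx by simp
  qed
  then have "Epq p q \<alpha> (\<lambda>x. \<rho> x / \<psi> x) \<kappa> \<le> liminf ?W / ennreal k"
    using pq by (simp add: Epq_def Lnorm_def v_def Inf_lower)
  then have "ennreal k * Epq p q \<alpha> (\<lambda>x. \<rho> x / \<psi> x) \<kappa> \<le> liminf ?W" using ennreal_mult_le_iff[OF k] by simp
  moreover have "ennreal k = ennreal ((bump_const r)\<^sup>2 / 128) * epowr (ennreal L) \<alpha>"
    using L_nonneg by (simp add: k_def epowr_ennreal ennreal_mult[symmetric])
  ultimately show ?thesis by simp
qed

text \<open>The integral in \<open>Epq\<close> is approached from above by step functions built from
  one representative per good interval. Their integrals are multiples of the sums in
  \<open>worst_err_ge_sum\<close>, because all knot intervals have equal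
  \<open>K\<close>-mass.\<close>

lemma liminf_worst_err_q_less_p:
  assumes pq: "\<not> p \<le> q" and B: "\<And>n. 1 \<le> n \<Longrightarrow> admissible n (B n)"
  shows "ennreal ((bump_const r)\<^sup>2 / 128) * epowr (ennreal L) \<alpha> * Epq p q \<alpha> (\<lambda>x. \<rho> x / \<psi> x) \<kappa>
    \<le> liminf (\<lambda>n. worst_err r p q \<psi> \<rho> (B n) * ennreal (real n powr (real r - max 0 (inv_exp p - inv_exp q))))"
    (is "_ \<le> liminf ?W")
proof -
  define \<sigma> where "\<sigma> = inv_exp q - inv_exp p"
  have qfin: "q \<noteq> \<infinity>" using pq by auto
  note qf = exponent_finite[OF q qfin]
  have \<sigma>: "0 < \<sigma>"
  proof (cases "p = \<infinity>")
    case True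
    then show ?thesis using qf by (simp add: \<sigma>_def inv_exp_def)
  next
    case False
    note pf = exponent_finite[OF p False]
    have "ennreal (enn2real q) < ennreal (enn2real p)" using pq pf qf by simp
    then have "enn2real q < enn2real p" using qf by (subst (asm) ennreal_less_iff) auto
    then show ?thesis using qf pf by (simp add: \<sigma>_def frac_less2)
  qed
  have exp: "real r - max 0 (inv_exp p - inv_exp q) = real r" "real r - \<alpha> = - \<sigma>"
    using \<sigma> by (simp_all add: \<sigma>_def alpha_def)
  define k where "k = (bump_const r)\<^sup>2 / 128 * L powr \<alpha>"
  have k: "0 < k" using bump_const(1)[of r] L_pos by (simp add: k_def)
  define G where "G n = {i. \<exists>a b y. good n i a b y}" for n
  have Gfin: "finite (G n)" for n
    by (rule finite_subset[of _ "{..<n}"]) (auto simp: G_def good_def knot_interval_def)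
  have "\<forall>n i. \<exists>a b y. i \<in> G n \<longrightarrow> good n i a b y" by (auto simp: G_def)
  then obtain a b y where good: "\<And>n i. i \<in> G n \<Longrightarrow> good n i (a n i) (b n i) (y n i)" by metis
  \<comment> \<open>By \<open>good_compare\<close> the factor 8 makes \<open>V n\<close> dominate v
    at every point that is good for n, hence almost everywhere from some n on. Points not good for n
    may lie in the same intervals; they only enlarge the integral.\<close>
  define V where "V n x = (\<Sum>i\<in>G n. 8 * v (y n i) * indicator {a n i..<b n i} x)" for n x
  define u where "u n x = ennreal (K x / L * V n x powr (1 / \<sigma>))" for n x
  define Z where "Z n = (\<Sum>i\<in>G n. v (y n i) powr (1 / \<sigma>))" for n
  have vy: "0 < v (y n i)" if "i \<in> G n" for n i using good_imp(4)[OF good[OF that]] by (rule v_pos)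
  have V_eq: "V n x = 8 * v (y n i)" if "i \<in> G n" "a n i \<le> x" "x < b n i" for n i x
  proof -
    have "V n x = (\<Sum>j\<in>G n. if j = i then 8 * v (y n i) else 0)"
      unfolding V_def
    proof (rule sum.cong)
      fix j assume j: "j \<in> G n"
      show "8 * v (y n j) * indicator {a n j..<b n j} x = (if j = i then 8 * v (y n i) else 0)"
      proof (cases "j = i")
        case False
        then have "x \<notin> {a n j..<b n j}"
          using knot_interval_disjoint[OF good_imp(1)[OF good[OF j]] good_imp(1)[OF good[OF that(1)]] _ _ that(2,3)]
          by auto
        then show ?thesis using False by simp
      qed (use that in simp)
    qed simp
    then show ?thesis using that(1) Gfin by simp
  qed
  have V_0: "V n x = 0" if "\<And>i. i \<in> G n \<Longrightarrow> \<not> (a n i \<le> x \<and> x < b n i)" for n x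
    unfolding V_def using that by (intro sum.neutral) (auto simp: indicator_def)
  \<comment> \<open>Every knot interval has \<open>K\<close>-mass L/n, so integrating against
    \<open>K / L\<close> gives each representative the weight 1/n.\<close>
  have int_u: "(\<integral>\<^sup>+ x. u n x \<partial>LD) \<le> ennreal (8 powr (1 / \<sigma>) * Z n / real n)" for n
  proof -
    have pw: "u n x \<le> (\<Sum>i\<in>G n. ennreal ((8 * v (y n i)) powr (1 / \<sigma>) / L) * ennreal (indicator {a n i..b n i} x * K x))" for x
    proof (cases "\<exists>i\<in>G n. a n i \<le> x \<and> x < b n i")
      case True
      then obtain i where i: "i \<in> G n" "a n i \<le> x" "x < b n i" by auto
      have "u n x = ennreal ((8 * v (y n i)) powr (1 / \<sigma>) / L) * ennreal (indicator {a n i..b n i} x * K x)"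
        using i V_eq[OF i] L_pos K_nonneg by (simp add: u_def ennreal_mult[symmetric] mult.commute)
      also have "\<dots> \<le> (\<Sum>i\<in>G n. ennreal ((8 * v (y n i)) powr (1 / \<sigma>) / L) * ennreal (indicator {a n i..b n i} x * K x))"
        using i Gfin by (intro member_le_sum) auto
      finally show ?thesis .
    next
      case False
      then have "V n x = 0" by (intro V_0) auto
      then show ?thesis by (simp add: u_def)
    qed
    have meas: "(\<lambda>x. ennreal (indicator {a n i..b n i} x * K x)) \<in> borel_measurable LD" for i
    proof -
      have "{a n i..b n i} \<inter> {0..} \<in> sets LD" by (subst sets_restrict_space_iff) auto
      moreover have "K \<in> borel_measurable LD" using K_integrable by (rule borel_measurable_integrable)
      moreover have "(\<lambda>x. indicator {a n i..b n i} x :: real) \<in> borel_measurable LD"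
        by (intro measurable_restrict_space1 borel_measurable_indicator) auto
      ultimately show ?thesis by (intro measurable_compose[OF _ measurable_ennreal] borel_measurable_times)
    qed
    have int: "(\<integral>\<^sup>+ x. ennreal (indicator {a n i..b n i} x * K x) \<partial>LD) = ennreal (L / real n)" if "i \<in> G n" for i
    proof -
      note g = good_imp[OF good[OF that]]
      have "F (b n i) = F (a n i) + integral {a n i..b n i} K"
        using Henstock_Kurzweil_Integration.integral_combine[of 0 "a n i" "b n i" K] g K_int by (simp add: F_def)
      moreover have "F (b n i) - F (a n i) = L / real n"
        using g by (simp add: knot_interval_def field_simps)
      ultimately have "integral {a n i..b n i} K = L / real n" by simp
      then show ?thesis using nn_integral_K[OF g(2), of "b n i"] by simp
    qed
    have "(\<integral>\<^sup>+ x. u n x \<partial>LD) \<le>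
        (\<integral>\<^sup>+ x. (\<Sum>i\<in>G n. ennreal ((8 * v (y n i)) powr (1 / \<sigma>) / L) * ennreal (indicator {a n i..b n i} x * K x)) \<partial>LD)"
      by (intro nn_integral_mono pw)
    also have "\<dots> = (\<Sum>i\<in>G n. \<integral>\<^sup>+ x. ennreal ((8 * v (y n i)) powr (1 / \<sigma>) / L) * ennreal (indicator {a n i..b n i} x * K x) \<partial>LD)"
      using meas by (intro nn_integral_sum borel_measurable_times_ennreal) auto
    also have "\<dots> = (\<Sum>i\<in>G n. ennreal (8 powr (1 / \<sigma>) * v (y n i) powr (1 / \<sigma>) / real n))"
    proof (rule sum.cong)
      fix i assume i: "i \<in> G n"
      have "(\<integral>\<^sup>+ x. ennreal ((8 * v (y n i)) powr (1 / \<sigma>) / L) * ennreal (indicator {a n i..b n i} x * K x) \<partial>LD)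
        = ennreal ((8 * v (y n i)) powr (1 / \<sigma>) / L) * ennreal (L / real n)"
        using meas by (subst nn_integral_cmult) (simp_all only: int[OF i])
      then show "(\<integral>\<^sup>+ x. ennreal ((8 * v (y n i)) powr (1 / \<sigma>) / L) * ennreal (indicator {a n i..b n i} x * K x) \<partial>LD)
        = ennreal (8 powr (1 / \<sigma>) * v (y n i) powr (1 / \<sigma>) / real n)"
        using vy[OF i] L_pos by (simp add: ennreal_mult[symmetric] powr_mult)
    qed simp
    also have "\<dots> = ennreal (8 powr (1 / \<sigma>) * Z n / real n)"
      by (subst sum_ennreal) (auto simp: Z_def sum_distrib_left sum_divide_distrib)
    finally show ?thesis .
  qed
  have u_meas: "u n \<in> borel_measurable LD" for n
  proof -
    have "K \<in> borel_measurable LD" using K_integrable by (rule borel_measurable_integrable)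
    moreover have "V n \<in> borel_measurable LD" unfolding V_def[abs_def]
      by (intro borel_measurable_sum borel_measurable_times borel_measurable_const
        measurable_restrict_space1 borel_measurable_indicator) auto
    ultimately show ?thesis unfolding u_def[abs_def] by measurable
  qed
  define J where "J = (\<integral>\<^sup>+ x. ennreal (K x / L * v x powr (1 / \<sigma>)) \<partial>LD)"
  have "J \<le> (\<integral>\<^sup>+ x. liminf (\<lambda>n. u n x) \<partial>LD)"
    unfolding J_def
  proof (rule nn_integral_mono_AE)
    show "AE x in LD. ennreal (K x / L * v x powr (1 / \<sigma>)) \<le> liminf (\<lambda>n. u n x)"
      using AE_eventually_good
    proof eventually_elim
      case (elim x)
      then have vx: "0 < v x" by (intro v_pos) simp
      have "\<forall>\<^sub>F n in sequentially. ennreal (K x / L * v x powr (1 / \<sigma>)) \<le> u n x"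
        using conjunct2[OF elim]
      proof eventually_elim
        case (elim n)
        then obtain i a' b' where g: "good n i a' b' x" by blast
        then have i: "i \<in> G n" by (auto simp: G_def)
        note uniq = knot_interval_unique[OF good_imp(1)[OF g] good_imp(1)[OF good[OF i]]]
        have "v x \<le> V n x"
          using good_compare[of n i a' b' x "y n i"] g good[OF i] V_eq[OF i, of x] uniq by (auto simp: good_def)
        then have "v x powr (1 / \<sigma>) \<le> V n x powr (1 / \<sigma>)" using vx \<sigma> by (intro powr_mono2) auto
        then show ?case unfolding u_def using K_nonneg L_pos by (intro ennreal_leI mult_left_mono) auto
      qed
      then show ?case by (rule Liminf_bounded)
    qed
  qed
  also have "\<dots> \<le> liminf (\<lambda>n. \<integral>\<^sup>+ x. u n x \<partial>LD)"
    using u_meas by (rule nn_integral_liminf)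
  finally have J: "J \<le> liminf (\<lambda>n. \<integral>\<^sup>+ x. u n x \<partial>LD)" .
  have "ennreal k * epowr J \<sigma> \<le> liminf ?W"
  proof (rule liminf_epowr_lower[OF k \<sigma> J])
    show "\<forall>\<^sub>F n in sequentially. ennreal k * epowr (\<integral>\<^sup>+ x. u n x \<partial>LD) \<sigma> \<le> ?W n"
      using eventually_ge_at_top[of 1]
    proof eventually_elim
      case (elim n)
      have Z0: "0 \<le> Z n" unfolding Z_def by (intro sum_nonneg) auto
      have "epowr (\<integral>\<^sup>+ x. u n x \<partial>LD) \<sigma> \<le> epowr (ennreal (8 powr (1 / \<sigma>) * Z n / real n)) \<sigma>"
        using int_u \<sigma> by (rule epowr_mono)
      also have "\<dots> = ennreal (8 * Z n powr \<sigma> / real n powr \<sigma>)"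
        using Z0 \<sigma> elim by (simp add: epowr_ennreal powr_mult powr_divide powr_powr)
      finally have "ennreal k * epowr (\<integral>\<^sup>+ x. u n x \<partial>LD) \<sigma> \<le> ennreal k * ennreal (8 * Z n powr \<sigma> / real n powr \<sigma>)"
        by (rule mult_left_mono) simp
      also have "\<dots> = ennreal (k * (8 * Z n powr \<sigma> / real n powr \<sigma>))"
        using k by (simp add: ennreal_mult[symmetric])
      also have "\<dots> \<le> ?W n"
      proof (cases "G n = {}")
        case True
        \<comment> \<open>Without good intervals the sum is 0 and
          \<open>0 powr \<sigma> = 0\<close>, so the claim is trivial.\<close>
        then show ?thesis using \<sigma> by (simp add: Z_def)
      next
        case False
        \<comment> \<open>Here the rate is \<open>n powr r\<close> with r = \<alpha> - \<sigma>.
          After \<alpha> cancels, the power -\<sigma> of n is exactly the normalisation 1/n of the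
          average, raised to the power \<sigma>. The 8 from \<open>V\<close> turns 128 back into
          16.\<close>
        have "k * (8 * Z n powr \<sigma> / real n powr \<sigma>)
            = (bump_const r)\<^sup>2 / 16 * (L / real n) powr \<alpha> * Z n powr \<sigma> * real n powr real r"
        proof -
          have "real n powr real r = real n powr \<alpha> / real n powr \<sigma>"
          proof -
            have "real r = \<alpha> - \<sigma>" using exp(2) by simp
            then show ?thesis by (simp only: powr_diff)
          qed
          then show ?thesis using elim L_pos by (simp add: k_def powr_divide)
        qed
        then have "ennreal (k * (8 * Z n powr \<sigma> / real n powr \<sigma>))
            = ennreal ((bump_const r)\<^sup>2 / 16 * (L / real n) powr \<alpha> * Z n powr \<sigma>) * ennreal (real n powr real r)"
          by (simp only: ennreal_mult'' powr_ge_zero)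
        also have "\<dots> \<le> ?W n"
          unfolding exp(1) Z_def
          by (intro mult_right_mono worst_err_ge_sum[OF B[OF elim] pq Gfin False good \<sigma>_def \<sigma>]) auto
        finally show ?thesis .
      qed
      finally show ?case .
    qed
  qed
  moreover have "ennreal k = ennreal ((bump_const r)\<^sup>2 / 128) * epowr (ennreal L) \<alpha>"
    using L_nonneg by (simp add: k_def epowr_ennreal ennreal_mult[symmetric])
  moreover have "epowr J \<sigma> = Epq p q \<alpha> (\<lambda>x. \<rho> x / \<psi> x) \<kappa>"
    using pq L_nonneg by (simp add: Epq_def J_def \<sigma>_def Lnorm_K K_def v_def)
  ultimately show ?thesis by simp
qed

end

theorem theorem2:
  fixes p q :: ennreal and r :: nat
  assumes "r \<ge> 1" and "1 \<le> p" and "1 \<le> q" and "alpha r p q > 0"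
  shows "\<exists>c2::real. c2 > 0 \<and>
    (\<forall>(\<psi>::real \<Rightarrow> real) (\<rho>::real \<Rightarrow> real) (\<kappa>::real \<Rightarrow> real)
       (A::nat \<Rightarrow> (real \<Rightarrow> real) \<Rightarrow> real \<Rightarrow> real).
      (\<forall>x\<ge>0. \<psi> x > 0) \<and> integrable (lebesgue_on {0..}) \<psi> \<and>
      (\<forall>x\<ge>0. \<rho> x > 0) \<and> integrable (lebesgue_on {0..}) \<rho> \<and>
      (\<forall>x\<ge>0. \<kappa> x > 0) \<and> (\<forall>x y. 0 \<le> x \<longrightarrow> x \<le> y \<longrightarrow> \<kappa> y \<le> \<kappa> x) \<and>
      Lnorm 1 (\<lambda>t. \<kappa> t powr (1 / alpha r p q)) < \<infinity> \<and>
      (\<forall>n\<ge>1. \<forall>f g. in_F r p \<psi> f \<longrightarrow> in_F r p \<psi> g \<longrightarrow>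
          (\<forall>t. is_knot \<kappa> (alpha r p q) n t \<longrightarrow> (\<forall>j<r. (Dw ^^ j) f t = (Dw ^^ j) g t)) \<longrightarrow>
          (\<forall>x\<ge>0. A n f x = A n g x)) \<and>
      (\<forall>n f. in_F r p \<psi> f \<longrightarrow> A n f \<in> borel_measurable (lebesgue_on {0..}))
      \<longrightarrow>
      liminf (\<lambda>n. worst_err r p q \<psi> \<rho> (A n)
                   * ennreal (real n powr (real r - max 0 (inv_exp p - inv_exp q))))
        \<ge> ennreal c2 * epowr (Lnorm 1 (\<lambda>t. \<kappa> t powr (1 / alpha r p q))) (alpha r p q)
            * Epq p q (alpha r p q) (\<lambda>x. \<rho> x / \<psi> x) \<kappa>)"
proof (intro exI[of _ "(bump_const r)\<^sup>2 / 128"] conjI allI impI)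
  \<comment> \<open>The constant is a function of r alone and is fixed before the weights, \<kappa>
    and the approximations.\<close>
  show "0 < (bump_const r)\<^sup>2 / 128" using bump_const(1)[of r] by simp
  fix \<psi> \<rho> \<kappa> :: "real \<Rightarrow> real" and A :: "nat \<Rightarrow> (real \<Rightarrow> real) \<Rightarrow> real \<Rightarrow> real"
  assume H: "(\<forall>x\<ge>0. \<psi> x > 0) \<and> integrable (lebesgue_on {0..}) \<psi> \<and>
      (\<forall>x\<ge>0. \<rho> x > 0) \<and> integrable (lebesgue_on {0..}) \<rho> \<and>
      (\<forall>x\<ge>0. \<kappa> x > 0) \<and> (\<forall>x y. 0 \<le> x \<longrightarrow> x \<le> y \<longrightarrow> \<kappa> y \<le> \<kappa> x) \<and>
      Lnorm 1 (\<lambda>t. \<kappa> t powr (1 / alpha r p q)) < \<infinity> \<and>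
      (\<forall>n\<ge>1. \<forall>f g. in_F r p \<psi> f \<longrightarrow> in_F r p \<psi> g \<longrightarrow>
          (\<forall>t. is_knot \<kappa> (alpha r p q) n t \<longrightarrow> (\<forall>j<r. (Dw ^^ j) f t = (Dw ^^ j) g t)) \<longrightarrow>
          (\<forall>x\<ge>0. A n f x = A n g x)) \<and>
      (\<forall>n f. in_F r p \<psi> f \<longrightarrow> A n f \<in> borel_measurable (lebesgue_on {0..}))"
  interpret sampling r p q \<psi> \<rho> \<kappa>
  proof
    show "\<psi> \<in> borel_measurable LD" "\<rho> \<in> borel_measurable LD"
      using H by (blast intro: borel_measurable_integrable)+
    show "0 < \<psi> x" "0 < \<rho> x" "0 < \<kappa> x" if "0 \<le> x" for x using H that by blast+
    show "\<kappa> y \<le> \<kappa> x" if "0 \<le> x" "x \<le> y" for x y using H that by blast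
    show "Lnorm 1 (\<lambda>t. \<kappa> t powr (1 / alpha r p q)) < \<infinity>" using H by blast
  qed (use assms in auto)
  have "admissible n (A n)" if "1 \<le> n" for n
    unfolding admissible_def using H that by blast
  then show "ennreal ((bump_const r)\<^sup>2 / 128) * epowr (Lnorm 1 (\<lambda>t. \<kappa> t powr (1 / alpha r p q))) (alpha r p q)
            * Epq p q (alpha r p q) (\<lambda>x. \<rho> x / \<psi> x) \<kappa>
      \<le> liminf (\<lambda>n. worst_err r p q \<psi> \<rho> (A n)
                   * ennreal (real n powr (real r - max 0 (inv_exp p - inv_exp q))))"
    unfolding Lnorm_K using liminf_worst_err_p_le_q liminf_worst_err_q_less_p by (cases "p \<le> q") blast+
qed

end
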